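(* Let $F=K(x,y)$ be the Kummer extension given by $y^m=f(x)^{\lambda}$, where $f(x)\in\mathbb{F}_q[x]$ is a separable polynomial of degree $r$ and $\gcd(m,r\lambda)=1$. Suppose that the genus $g$ of $F$ satisfies $g\ge 1$ and that $P$ is a place of $F$ that is totally ramified in $F/K(x)$. Then $$H(P)=\mathbb{N}_0\setminus\left\{1+i+mj \;\middle|\; i,j\in\mathbb{Z},\ 0\le i\le m-2-\lfloor m/r\rfloor,\ 0\le j\le r-2-\lfloor r(i+1)/m\rfloor\right\}\quad\text{if } P\neq P_\infty,$$ and $$H(P)=\langle m,r\rangle\quad\text{if } P=P_\infty.$$
   Context: $\mathbb{F}_q$ is a finite field of characteristic $p$ and $K$ is its algebraic closure. A Kummer extension here means the algebraic function field $F=K(x,y)$ over $K$ (with $x$ transcendental over $K$) defined by $y^m=f(x)^{\lambda}=\prod_{i=1}^r (x-\alpha_i)^\lambda$, where $m\ge 2$, $p\nmid m$, $\lambda$ is a positive integer, $f(x)\in\mathbb{F}_q[x]$, the elements $\alpha_1,\dots,\alpha_r\in K$ are pairwise distinct, and $\gcd(m,r\lambda)=1$. The places $Q_1,\dots,Q_r$ of $K(x)$ corresponding to the zeros $\alpha_1,\dots,\alpha_r$ of $f$ and the pole $Q_\infty$ of $x$ in $K(x)$ are totally ramified in $F/K(x)$; $P_i$ denotes the unique place of $F$ over $Q_i$, for $i=1,\dots,r,\infty$. For a place $P$ of $F$, the Weierstrass semigroup at $P$ is $H(P)=\{n\in\mathbb{N}_0 \mid (z)_\infty=nP \text{ for some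 } z\in F\}$, where $\mathbb{N}_0$ is the set of non-negative integers and $(z)_\infty$ is the pole divisor of $z$. $\langle n_1,\dots,n_k\rangle$ denotes the additive submonoid of $\mathbb{N}_0$ generated by $n_1,\dots,n_k$. *)

theory Defs
  imports
    Complex_Main
    "HOL-Algebra.Algebraic_Closure_Type"
    "HOL-Algebra.Finite_Extensions"
    "HOL-Algebra.Generated_Fields"
    "HOL-Algebra.QuotRing"
begin

text \<open>
  An algebraic function field over \<open>K\<close> is a subset \<open>L\<close> of a field type, with \<open>K \<subseteq> L\<close>; the
  intended instances are \<open>L = UNIV\<close> and \<open>L = K(x)\<close>. Subrings, ideals, vector space
  dimensions etc. are those of HOL-Algebra, via \<^const>\<open>ring_of_type_algebra\<close>.
\<close>

abbreviation sub_ring :: "'f::field set \<Rightarrow> 'f ring" where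
  "sub_ring S \<equiv> ring_of_type_algebra\<lparr>carrier := S\<rparr>"

definition field_gen :: "'f::field set \<Rightarrow> 'f set \<Rightarrow> 'f set" where
  "field_gen K S = generate_field ring_of_type_algebra (K \<union> S)"

section \<open>Places and valuations\<close>

definition valuation_ring :: "'f::field set \<Rightarrow> 'f set \<Rightarrow> 'f set \<Rightarrow> bool" where
  "valuation_ring K L V \<longleftrightarrow>
     subring V ring_of_type_algebra \<and> K \<subset> V \<and> V \<subset> L \<and> (\<forall>z\<in>L. z \<in> V \<or> inverse z \<in> V)"

definition places :: "'f::field set \<Rightarrow> 'f set \<Rightarrow> 'f set set" where
  "places K L = {P. \<exists>V. valuation_ring K L V \<and> maximalideal P (sub_ring V)}"

text \<open>The valuation ring \<open>\<O>\<^sub>P\<close> is determined by its maximal ideal \<open>P\<close>.\<close>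

definition place_ring :: "'f::field set \<Rightarrow> 'f set \<Rightarrow> 'f set \<Rightarrow> 'f set" where
  "place_ring K L P = (THE V. valuation_ring K L V \<and> maximalideal P (sub_ring V))"

text \<open>
  The normalised discrete valuation of \<open>P\<close>: \<open>v\<^sub>P(z) = n\<close> iff \<open>z = t\<^sup>n u\<close> with \<open>u\<close> a unit and \<open>t\<close> a
  generator of \<open>P\<close>. It is only meaningful for \<open>z \<noteq> 0\<close> (there is no value \<open>\<infinity>\<close>), so \<open>z = 0\<close>
  is treated separately at every use.
\<close>

definition place_val :: "'f::field set \<Rightarrow> 'f set \<Rightarrow> 'f set \<Rightarrow> 'f \<Rightarrow> int" where
  "place_val K L P z =
     (let V = place_ring K L P in
      THE n. \<exists>t\<in>V. \<exists>u\<in>Units (sub_ring V). P = PIdl\<^bsub>sub_ring V\<^esub> t \<and> z = t powi n * u)"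

definition place_degree :: "'f::field set \<Rightarrow> 'f set \<Rightarrow> 'f set \<Rightarrow> nat" where
  "place_degree K L P =
     (let V = sub_ring (place_ring K L P) in
      ring.dim (V Quot P) ((\<lambda>k. P +>\<^bsub>V\<^esub> k) ` K) (carrier (V Quot P)))"

section \<open>Divisors and the genus\<close>

definition divisors :: "'f::field set \<Rightarrow> 'f set \<Rightarrow> ('f set \<Rightarrow> int) set" where
  "divisors K L = {D. finite {P. D P \<noteq> 0} \<and> {P. D P \<noteq> 0} \<subseteq> places K L}"

definition divisor_degree :: "'f::field set \<Rightarrow> 'f set \<Rightarrow> ('f set \<Rightarrow> int) \<Rightarrow> int" where
  "divisor_degree K L D = (\<Sum>P | D P \<noteq> 0. D P * int (place_degree K L P))"

definition riemann_roch_space :: "'f::field set \<Rightarrow> 'f set \<Rightarrow> ('f set \<Rightarrow> int) \<Rightarrow> 'f set" where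
  "riemann_roch_space K L D =
     {z \<in> L. z \<noteq> 0 \<longrightarrow> (\<forall>P\<in>places K L. place_val K L P z \<ge> - D P)}"

text \<open>\<open>g = max {deg D - \<ell>(D) + 1 | D a divisor}\<close>; the maximum exists by Riemann's theorem.\<close>

definition genus :: "'f::field set \<Rightarrow> 'f set \<Rightarrow> int" where
  "genus K L = (GREATEST g. \<exists>D\<in>divisors K L.
     g = divisor_degree K L D
         - int (ring.dim ring_of_type_algebra K (riemann_roch_space K L D)) + 1)"

section \<open>Weierstrass semigroups\<close>

definition pole_divisor :: "'f::field set \<Rightarrow> 'f set \<Rightarrow> 'f \<Rightarrow> 'f set \<Rightarrow> int" where
  "pole_divisor K L z =
     (\<lambda>P. if P \<in> places K L \<and> place_val K L P z < 0 then - place_val K L P z else 0)"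

definition weierstrass_semigroup :: "'f::field set \<Rightarrow> 'f set \<Rightarrow> 'f set \<Rightarrow> nat set" where
  "weierstrass_semigroup K L P =
     {n. \<exists>z\<in>L. z \<noteq> 0 \<and> pole_divisor K L z = (\<lambda>Q. if Q = P then int n else 0)}"

definition generated_submonoid :: "nat set \<Rightarrow> nat set" where
  "generated_submonoid S = (\<lambda>M. 0 \<in> M \<and> (\<forall>a\<in>M. \<forall>b\<in>M. a + b \<in> M)) hull S"

section \<open>Ramification\<close>

text \<open>
  Here \<open>E \<subseteq> L\<close> are function fields over \<open>K\<close>. A place \<open>P\<close> of \<open>L\<close> lies over a place \<open>Q\<close> of \<open>E\<close>
  if \<open>Q \<subseteq> P\<close>.
\<close>

definition places_over :: "'f::field set \<Rightarrow> 'f set \<Rightarrow> 'f set \<Rightarrow> 'f set set" where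
  "places_over K L Q = {P \<in> places K L. Q \<subseteq> P}"

definition ramification_index ::
    "'f::field set \<Rightarrow> 'f set \<Rightarrow> 'f set \<Rightarrow> 'f set \<Rightarrow> 'f set \<Rightarrow> nat" where
  "ramification_index K E L Q P =
     (THE e. \<forall>z\<in>E - {0}. place_val K L P z = int e * place_val K E Q z)"

definition totally_ramified :: "'f::field set \<Rightarrow> 'f set \<Rightarrow> 'f set \<Rightarrow> 'f set \<Rightarrow> bool" where
  "totally_ramified K E L P \<longleftrightarrow>
     (\<exists>Q\<in>places K E. places_over K L Q = {P} \<and>
        ramification_index K E L Q P = ring.dim ring_of_type_algebra E L)"

section \<open>The Kummer extension\<close>

text \<open>
  The finite field is the type \<open>'q\<close>, its algebraic closure is \<open>'q alg_closure\<close>, and the function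
  field \<open>F\<close> is the type \<open>'f\<close>, into which the algebraic closure is embedded by \<open>emb\<close>.
\<close>

locale kummer_extension =
  fixes emb :: "'q::finite_field alg_closure \<Rightarrow> 'f::field"
    and x y :: 'f
    and f :: "'q poly"
    and m l r :: nat
    and \<alpha> :: "nat \<Rightarrow> 'q alg_closure"
  assumes emb: "emb \<in> ring_hom ring_of_type_algebra ring_of_type_algebra"
    and transcendental: "ring.transcendental ring_of_type_algebra (range emb) x"
    and generated: "field_gen (range emb) {x, y} = UNIV"
    and m_ge_2: "m \<ge> 2"
    and not_dvd: "\<not> CHAR('q) dvd m"
    and l_pos: "l > 0"
    and coprime: "coprime m (r * l)"
    and \<alpha>_distinct: "inj_on \<alpha> {1..r}"
    and f_factors: "map_poly to_ac f ^ l = (\<Prod>i=1..r. [:- \<alpha> i, 1:] ^ l)"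
    and equation: "y ^ m = poly (map_poly (\<lambda>a. emb (to_ac a)) f) x ^ l"

text \<open>\<open>Q\<^sub>\<infinity>\<close> is the pole of \<open>x\<close> in \<open>K(x)\<close>, and \<open>P\<^sub>\<infinity>\<close> is the place of \<open>F\<close> over it.\<close>

definition Q_infty :: "'f::field set \<Rightarrow> 'f \<Rightarrow> 'f set" where
  "Q_infty K x = (THE Q. Q \<in> places K (field_gen K {x}) \<and> place_val K (field_gen K {x}) Q x < 0)"

definition P_infty :: "'f::field set \<Rightarrow> 'f \<Rightarrow> 'f set" where
  "P_infty K x = (THE P. P \<in> places_over K UNIV (Q_infty K x))"

end

theory Submission
  imports Defs
begin

text \<open>
  Let \<open>a \<lambda> + b m = 1\<close>. The element \<open>w = y\<^sup>a f(x)\<^sup>b\<close> satisfies \<open>w\<^sup>m = f(x)\<close> and \<open>y = w\<^sup>\<lambda>\<close>, so \<open>F = K(x, w)\<close> and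
  the exponent \<open>\<lambda>\<close> may be taken to be \<open>1\<close>. Every element of \<open>F\<close> is a quotient
  \<open>(\<Sum>\<^sub>j p\<^sub>j(x) w\<^sup>j) / D(x)\<close> with \<open>0 \<le> j < m\<close> and polynomials \<open>p\<^sub>j\<close> and \<open>D\<close>.

  At infinity \<open>x\<close> and \<open>w\<close> have the values \<open>-m\<close> and \<open>-r\<close>, and at a zero \<open>a\<close> of \<open>f\<close> the elements \<open>x - a\<close> and \<open>w\<close>
  have the values \<open>m\<close> and \<open>1\<close>. At both kinds of places the values of the terms \<open>p\<^sub>j(x) w\<^sup>j\<close> are
  pairwise distinct modulo \<open>m\<close>; at infinity this is because \<open>m\<close> and \<open>r\<close> are coprime. Hence the value of a sum is the least
  value of its terms, and a sum is regular if and only if all its terms are. Over a point \<open>a\<close>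
  with \<open>f(a) \<noteq> 0\<close> there are \<open>m\<close> places, one for each \<open>m\<close>-th root \<open>b\<close> of \<open>f(a)\<close>, all unramified. If
  \<open>\<Sum>\<^sub>j p\<^sub>j(x) w\<^sup>j\<close> vanishes at all of them, then \<open>\<Sum>\<^sub>j p\<^sub>j(a) B\<^sup>j\<close> is a polynomial in \<open>B\<close> of degree
  less than \<open>m\<close> with \<open>m\<close> zeros, so all \<open>p\<^sub>j(a)\<close> are zero. In this way \<open>x - a\<close> can be cancelled from
  the denominator of a function that is regular over \<open>a\<close> (\<open>regular_outside_imp_quotient\<close>).

  A function with poles only at infinity therefore has a constant denominator, and its pole order is
  one of the numbers \<open>m i + r j\<close>; these are attained by \<open>x\<^sup>i w\<^sup>j\<close> (\<open>weierstrass_semigroup_infinite\<close>).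
  A function with poles only at the place over a zero \<open>a\<close> of \<open>f\<close> has a power of \<open>x - a\<close> as its denominator,
  and all its terms are regular at infinity; its pole order has the form \<open>m k - j\<close> with \<open>j < m\<close> and
  \<open>r j \<le> m k\<close>, and this is attained by \<open>w\<^sup>j / (x - a)\<^sup>k\<close> (\<open>weierstrass_semigroup_root\<close>). The numbers
  \<open>m k - j\<close> with \<open>m k < r j\<close> remain as gaps, and \<open>i = m - 1 - j\<close> brings them into the stated form
  (\<open>gaps_eq\<close>). A totally ramified place is alone in its fibre, so it lies over infinity or over a
  zero of \<open>f\<close> (\<open>unique_over_imp_root\<close>).

  The argument requires all places of \<open>F\<close>. They are given by valuation rings, whose existence
  follows from Zorn's lemma (\<open>valuation_subring_exists\<close>); that these are discrete is read off from the
  explicit uniformizers (\<open>place_subring_discrete\<close>). Inverses in \<open>F\<close>, residues and values are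
  controlled by the norm from \<open>F\<close> to \<open>K(x)\<close>, the product of the conjugates under \<open>w \<mapsto> c w\<close> with \<open>c\<^sup>m = 1\<close>
  (\<open>norm_exists\<close>).
\<close>

section \<open>Valuation rings in elementary terms\<close>

lemma ring_of_type_algebra_sel [simp]:
  "carrier ring_of_type_algebra = UNIV"
  "(\<otimes>\<^bsub>ring_of_type_algebra\<^esub>) = (\<lambda>a b :: 'a::comm_ring_1. a * b)"
  "\<one>\<^bsub>ring_of_type_algebra\<^esub> = 1"
  "\<zero>\<^bsub>ring_of_type_algebra\<^esub> = 0"
  "(\<oplus>\<^bsub>ring_of_type_algebra\<^esub>) = (\<lambda>a b :: 'a::comm_ring_1. a + b)"
  by (simp_all add: ring_of_type_algebra_def)

lemma a_inv_ring_of_type_algebra [simp]: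
  "\<ominus>\<^bsub>ring_of_type_algebra\<^esub> (a :: 'a::comm_ring_1) = - a"
proof -
  interpret R: ring "ring_of_type_algebra :: 'a ring" ..
  show ?thesis
    using R.minus_equality[of "- a" a] by simp
qed

lemma m_inv_ring_of_type_algebra:
  assumes "(a :: 'a::field) \<noteq> 0"
  shows "inv\<^bsub>ring_of_type_algebra\<^esub> a = inverse a"
proof -
  interpret R: cring "ring_of_type_algebra :: 'a ring" ..
  show ?thesis
    using R.comm_inv_char[of a "inverse a"] assms by simp
qed

definition is_subring :: "'a::comm_ring_1 set \<Rightarrow> bool" where
  "is_subring V \<longleftrightarrow> 1 \<in> V \<and> (\<forall>a\<in>V. \<forall>b\<in>V. a - b \<in> V) \<and> (\<forall>a\<in>V. \<forall>b\<in>V. a * b \<in> V)"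

lemma is_subringD:
  assumes "is_subring V"
  shows "1 \<in> V" and "0 \<in> V"
    and "a \<in> V \<Longrightarrow> - a \<in> V"
    and "a \<in> V \<Longrightarrow> b \<in> V \<Longrightarrow> a - b \<in> V"
    and "a \<in> V \<Longrightarrow> b \<in> V \<Longrightarrow> a + b \<in> V"
    and "a \<in> V \<Longrightarrow> b \<in> V \<Longrightarrow> a * b \<in> V"
    and "a \<in> V \<Longrightarrow> a ^ n \<in> V"
proof -
  show one: "1 \<in> V" and diff: "\<And>a b. a \<in> V \<Longrightarrow> b \<in> V \<Longrightarrow> a - b \<in> V"
    and mult: "\<And>a b. a \<in> V \<Longrightarrow> b \<in> V \<Longrightarrow> a * b \<in> V"
    using assms by (auto simp: is_subring_def)
  show zero: "0 \<in> V" using diff[OF one one] by simp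
  show neg: "\<And>a. a \<in> V \<Longrightarrow> - a \<in> V" using diff[OF zero] by simp
  show "a \<in> V \<Longrightarrow> b \<in> V \<Longrightarrow> a + b \<in> V" using diff[OF _ neg, of a b] by simp
  show "a \<in> V \<Longrightarrow> a ^ n \<in> V" by (induction n) (auto intro: one mult)
qed

lemma is_subring_sum:
  "is_subring V \<Longrightarrow> (\<And>i. i \<in> I \<Longrightarrow> g i \<in> V) \<Longrightarrow> sum g I \<in> V"
  by (induction I rule: infinite_finite_induct) (auto intro: is_subringD)

lemma subring_iff_is_subring:
  "subring V (ring_of_type_algebra :: 'a::comm_ring_1 ring) \<longleftrightarrow> is_subring V"
proof -
  interpret R: ring "ring_of_type_algebra :: 'a ring" ..
  show ?thesis
  proof
    assume "subring V ring_of_type_algebra"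
    note V = subringE[OF this, simplified]
    show "is_subring V"
      using V unfolding is_subring_def by (metis diff_conv_add_uminus)
  next
    assume "is_subring V"
    note V = is_subringD[OF this]
    show "subring V ring_of_type_algebra"
      by (rule R.subringI) (auto intro: V)
  qed
qed

definition is_unit_in :: "'f::field set \<Rightarrow> 'f \<Rightarrow> bool" where
  "is_unit_in V u \<longleftrightarrow> u \<noteq> 0 \<and> u \<in> V \<and> inverse u \<in> V"

definition nonunits :: "'f::field set \<Rightarrow> 'f set" where
  "nonunits V = {z \<in> V. \<not> is_unit_in V z}"

text \<open>
  As this makes sense for a single element, values can be computed before the ring is known to be
  discrete; indeed it is shown to be discrete by computing enough values.
\<close>

definition has_value :: "'f::field set \<Rightarrow> 'f \<Rightarrow> int \<Rightarrow> 'f \<Rightarrow> bool" where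
  "has_value V t n z \<longleftrightarrow> (\<exists>u. is_unit_in V u \<and> z = t powi n * u)"

locale valuation_subring =
  fixes L V :: "'f::field set"
  assumes subring: "is_subring V"
    and subset: "V \<subseteq> L"
    and L_mult: "a \<in> L \<Longrightarrow> b \<in> L \<Longrightarrow> a * b \<in> L"
    and L_inverse: "a \<in> L \<Longrightarrow> inverse a \<in> L"
    and valuation: "a \<in> L \<Longrightarrow> a \<in> V \<or> inverse a \<in> V"
begin

lemmas V_closed = is_subringD[OF subring]

lemma unit_mult: "is_unit_in V a \<Longrightarrow> is_unit_in V b \<Longrightarrow> is_unit_in V (a * b)"
  by (auto simp: is_unit_in_def intro: V_closed)

lemma unit_inverse: "is_unit_in V a \<Longrightarrow> is_unit_in V (inverse a)"
  by (auto simp: is_unit_in_def)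

lemma unit_one: "is_unit_in V 1"
  by (auto simp: is_unit_in_def intro: V_closed)

lemma unit_power: "is_unit_in V a \<Longrightarrow> is_unit_in V (a ^ n)"
  by (induction n) (auto intro: unit_one unit_mult)

lemma unit_powi: "is_unit_in V a \<Longrightarrow> is_unit_in V (a powi n)"
  by (simp add: power_int_def unit_power unit_inverse)

lemma nonunits_iff: "z \<in> nonunits V \<longleftrightarrow> z \<in> V \<and> (z = 0 \<or> inverse z \<notin> V)"
  by (auto simp: nonunits_def is_unit_in_def)

lemma nonunits_mult: "a \<in> nonunits V \<Longrightarrow> b \<in> V \<Longrightarrow> a * b \<in> nonunits V"
proof -
  assume a: "a \<in> nonunits V" and b: "b \<in> V"
  have "inverse a \<in> V" if "inverse (a * b) \<in> V" "a * b \<noteq> 0"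
  proof -
    have "inverse a = inverse (a * b) * b" using that by (simp add: field_simps)
    then show ?thesis using that b V_closed(6) by metis
  qed
  then show ?thesis using a b by (auto simp: nonunits_iff intro: V_closed)
qed

lemma nonunits_mult': "a \<in> V \<Longrightarrow> b \<in> nonunits V \<Longrightarrow> a * b \<in> nonunits V"
  using nonunits_mult[of b a] by (simp add: mult.commute)

lemma zero_nonunit: "0 \<in> nonunits V"
  by (auto simp: nonunits_iff intro: V_closed)

lemma nonunits_add: "a \<in> nonunits V \<Longrightarrow> b \<in> nonunits V \<Longrightarrow> a + b \<in> nonunits V"
proof -
  have *: "a + b \<in> nonunits V" if "a \<in> nonunits V" "b \<in> nonunits V" "a / b \<in> V" "b \<noteq> 0" for a b
  proof -
    have "b * (a / b + 1) \<in> nonunits V"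
      using that by (intro nonunits_mult V_closed) auto
    moreover have "b * (a / b + 1) = a + b" using that by (simp add: field_simps)
    ultimately show ?thesis by simp
  qed
  assume ab: "a \<in> nonunits V" "b \<in> nonunits V"
  show ?thesis
  proof (cases "a = 0 \<or> b = 0")
    case True
    then show ?thesis using ab by auto
  next
    case False
    have "a \<in> L" "b \<in> L" using ab subset by (auto simp: nonunits_iff)
    then have "a / b \<in> V \<or> inverse (a / b) \<in> V"
      by (intro valuation) (simp add: divide_inverse L_mult L_inverse)
    then show ?thesis
      using *[of a b] *[of b a] ab False by (auto simp: add.commute)
  qed
qed

lemma nonunits_minus: "a \<in> nonunits V \<Longrightarrow> - a \<in> nonunits V"
  using nonunits_mult[of a "-1"] by (auto intro: V_closed)

lemma nonunits_diff: "a \<in> nonunits V \<Longrightarrow> b \<in> nonunits V \<Longrightarrow> a - b \<in> nonunits V"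
  using nonunits_add[of a "- b"] nonunits_minus[of b] by simp

lemma one_not_nonunit: "1 \<notin> nonunits V"
  by (auto simp: nonunits_iff intro: V_closed)

lemma unit_not_nonunit: "is_unit_in V a \<Longrightarrow> a \<notin> nonunits V"
  by (auto simp: nonunits_def)

lemma unit_or_nonunit: "a \<in> V \<Longrightarrow> is_unit_in V a \<or> a \<in> nonunits V"
  by (auto simp: nonunits_def)

lemma unit_plus_nonunit:
  assumes "is_unit_in V u" "a \<in> nonunits V"
  shows "is_unit_in V (u + a)"
proof (rule ccontr)
  assume "\<not> is_unit_in V (u + a)"
  then have "u + a \<in> nonunits V"
    using assms by (auto simp: nonunits_def is_unit_in_def intro: V_closed)
  then have "u + a - a \<in> nonunits V" using assms nonunits_diff by blast
  then show False using assms unit_not_nonunit by auto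
qed

lemma nonunits_prime: "a * b \<in> nonunits V \<Longrightarrow> a \<in> V \<Longrightarrow> b \<in> V \<Longrightarrow> a \<in> nonunits V \<or> b \<in> nonunits V"
  using unit_mult[of a b] by (auto simp: nonunits_def)

lemma nonunits_prime_power: "a ^ n \<in> nonunits V \<Longrightarrow> a \<in> V \<Longrightarrow> a \<in> nonunits V"
  using unit_power[of a n] by (auto simp: nonunits_def)

lemma not_mem_imp_inverse_nonunit: "a \<in> L \<Longrightarrow> a \<notin> V \<Longrightarrow> inverse a \<in> nonunits V"
  using valuation[of a] V_closed(2) by (auto simp: nonunits_iff)

lemma nonunits_sum: "(\<And>i. i \<in> I \<Longrightarrow> g i \<in> nonunits V) \<Longrightarrow> sum g I \<in> nonunits V"
  by (induction I rule: infinite_finite_induct) (auto intro: nonunits_add zero_nonunit)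

lemma has_value_unit: "is_unit_in V u \<Longrightarrow> has_value V t 0 u"
  by (auto simp: has_value_def)

lemma has_value_self: "has_value V t 1 t"
  using unit_one by (auto simp: has_value_def)

lemma has_value_mult:
  "t \<noteq> 0 \<Longrightarrow> has_value V t a z \<Longrightarrow> has_value V t b z' \<Longrightarrow> has_value V t (a + b) (z * z')"
proof -
  assume t: "t \<noteq> 0" and "has_value V t a z" "has_value V t b z'"
  then obtain u u' where "is_unit_in V u" "is_unit_in V u'" "z = t powi a * u" "z' = t powi b * u'"
    by (auto simp: has_value_def)
  then show ?thesis
    using t unfolding has_value_def
    by (intro exI[of _ "u * u'"]) (auto simp: power_int_add intro: unit_mult)
qed

lemma has_value_inverse: "t \<noteq> 0 \<Longrightarrow> has_value V t a z \<Longrightarrow> has_value V t (- a) (inverse z)"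
proof -
  assume "has_value V t a z"
  then obtain u where "is_unit_in V u" "z = t powi a * u" by (auto simp: has_value_def)
  then show ?thesis
    unfolding has_value_def
    by (intro exI[of _ "inverse u"]) (auto simp: power_int_minus intro: unit_inverse)
qed

lemma has_value_divide:
  "t \<noteq> 0 \<Longrightarrow> has_value V t a z \<Longrightarrow> has_value V t b z' \<Longrightarrow> has_value V t (a - b) (z / z')"
  using has_value_mult[OF _ _ has_value_inverse, of t a z b z'] by (simp add: divide_inverse)

lemma has_value_power: "t \<noteq> 0 \<Longrightarrow> has_value V t a z \<Longrightarrow> has_value V t (int n * a) (z ^ n)"
proof (induction n)
  case 0
  then show ?case using has_value_unit[OF unit_one] by simp
next
  case (Suc n)
  then show ?case using has_value_mult[of t a z "int n * a" "z ^ n"] by (simp add: algebra_simps)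
qed

end

text \<open>
  A nonunit \<open>t\<close> that will serve as a uniformizer; here it is not yet assumed that all elements have
  a value.
\<close>

locale uniformized = valuation_subring L V for L V :: "'f::field set" +
  fixes t :: 'f
  assumes t_nonunit: "t \<in> nonunits V" and t_nz: "t \<noteq> 0"
begin

lemma powi_pos_nonunit:
  assumes "n > 0" shows "t powi n \<in> nonunits V"
proof -
  have "t powi n = t * t powi (n - 1)"
    using t_nz by (simp add: power_int_diff)
  moreover have "t powi (n - 1) \<in> V"
    using assms t_nonunit V_closed(7)[of t "nat (n - 1)"] by (auto simp: power_int_def nonunits_iff)
  ultimately show ?thesis using nonunits_mult[OF t_nonunit] by simp
qed

lemma has_value_nz: "has_value V t n z \<Longrightarrow> z \<noteq> 0"
  using t_nz by (auto simp: has_value_def is_unit_in_def)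

lemma has_value_pos: "has_value V t n z \<Longrightarrow> n > 0 \<Longrightarrow> z \<in> nonunits V"
  using nonunits_mult[OF powi_pos_nonunit] by (auto simp: has_value_def is_unit_in_def)

lemma has_value_mem_iff: "has_value V t n z \<Longrightarrow> z \<in> V \<longleftrightarrow> n \<ge> 0"
proof -
  assume z: "has_value V t n z"
  consider "n > 0" | "n = 0" | "n < 0" by linarith
  then show ?thesis
  proof cases
    case 1 then show ?thesis using has_value_pos[OF z] by (auto simp: nonunits_def)
  next
    case 2 then show ?thesis using z by (auto simp: has_value_def is_unit_in_def)
  next
    case 3
    then have "inverse z \<in> nonunits V"
      using has_value_pos[OF has_value_inverse[OF t_nz z]] by simp
    then show ?thesis using 3 has_value_nz[OF z] by (auto simp: nonunits_iff)
  qed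
qed

lemma has_value_nonunit_iff: "has_value V t n z \<Longrightarrow> z \<in> nonunits V \<longleftrightarrow> n > 0"
  using has_value_mem_iff[of n z] has_value_mem_iff[OF has_value_inverse[OF t_nz], of n z]
    has_value_nz[of n z]
  by (auto simp: nonunits_iff)

lemma has_value_unique: "has_value V t n z \<Longrightarrow> has_value V t n' z \<Longrightarrow> n = n'"
  using has_value_divide[OF t_nz, of n z n' z] has_value_nz[of n z]
    has_value_nonunit_iff[of "n - n'" 1] one_not_nonunit has_value_mem_iff[of "n - n'" 1] V_closed(1)
  by fastforce

text \<open>
  The strict triangle equality: the term of least value dominates the sum.
\<close>

lemma has_value_sum_distinct:
  assumes "finite J" "J \<noteq> {}" and val: "\<And>j. j \<in> J \<Longrightarrow> has_value V t (n j) (g j)"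
    and inj: "inj_on n J"
  shows "\<exists>j\<in>J. has_value V t (n j) (sum g J) \<and> (\<forall>i\<in>J. n j \<le> n i)"
proof -
  have "Min (n ` J) \<in> n ` J" using assms by (intro Min_in) auto
  then obtain j where j: "j \<in> J" "n j = Min (n ` J)" by auto
  have min: "n j \<le> n i" if "i \<in> J" for i using j that assms(1) by simp
  have less: "n j < n i" if "i \<in> J - {j}" for i
    using min[of i] that inj j by (auto simp: inj_on_def order.strict_iff_order)
  obtain u where u: "is_unit_in V u" "g j = t powi n j * u"
    using val[OF j(1)] by (auto simp: has_value_def)
  have "(\<Sum>i\<in>J - {j}. g i / t powi n j) \<in> nonunits V"
  proof (rule nonunits_sum)
    fix i assume i: "i \<in> J - {j}"
    have "has_value V t (n j) (t powi n j)"
      unfolding has_value_def using unit_one by (intro exI[of _ 1]) auto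
    with i have "has_value V t (n i - n j) (g i / t powi n j)"
      using val by (intro has_value_divide t_nz) auto
    then show "g i / t powi n j \<in> nonunits V"
      using less[OF i] has_value_pos by simp
  qed
  then have "is_unit_in V (u + (\<Sum>i\<in>J - {j}. g i / t powi n j))"
    by (rule unit_plus_nonunit[OF u(1)])
  moreover have "sum g J = t powi n j * (u + (\<Sum>i\<in>J - {j}. g i / t powi n j))"
    using assms(1) j(1) u(2) t_nz
    by (simp add: sum.remove[of J j] distrib_left sum_distrib_left)
  ultimately show ?thesis using j(1) min by (auto simp: has_value_def)
qed

end

locale discrete_valuation_subring = uniformized +
  assumes has_value_ex: "z \<in> L \<Longrightarrow> z \<noteq> 0 \<Longrightarrow> \<exists>n. has_value V t n z"

section \<open>Places and their valuations\<close>

context valuation_subring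
begin

lemma sub_ring_cring: "cring (sub_ring V)"
proof -
  interpret R: cring "ring_of_type_algebra :: 'f ring" ..
  show ?thesis
    using R.subcring_iff[of V] R.subcringI'[of V] subring subring_iff_is_subring[of V] by simp
qed

lemma Units_sub_ring: "Units (sub_ring V) = {u. is_unit_in V u}"
proof (intro equalityI subsetI)
  fix u assume "u \<in> Units (sub_ring V)"
  then obtain v where "u \<in> V" "v \<in> V" "u * v = 1" by (auto simp: Units_def)
  moreover from this have "inverse u = v" by (intro inverse_unique)
  ultimately show "u \<in> {u. is_unit_in V u}" by (auto simp: is_unit_in_def)
next
  fix u assume "u \<in> {u. is_unit_in V u}"
  then show "u \<in> Units (sub_ring V)"
    by (auto simp: Units_def is_unit_in_def intro!: bexI[of _ "inverse u"])
qed

lemma sub_ring_ideal_iff: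
  "ideal I (sub_ring V) \<longleftrightarrow>
     I \<subseteq> V \<and> 0 \<in> I \<and> (\<forall>a\<in>I. \<forall>b\<in>I. a + b \<in> I) \<and> (\<forall>a\<in>I. \<forall>b\<in>V. a * b \<in> I)"
  (is "_ \<longleftrightarrow> ?rhs")
proof -
  interpret S: cring "sub_ring V" by (rule sub_ring_cring)
  show ?thesis
  proof
    assume "ideal I (sub_ring V)"
    then interpret ideal I "sub_ring V" .
    show ?rhs
      using a_subset a_closed I_r_closed additive_subgroup.zero_closed[OF is_additive_subgroup]
      by auto
  next
    assume I: ?rhs
    show "ideal I (sub_ring V)"
    proof (rule idealI)
      show "subgroup I (add_monoid (sub_ring V))"
      proof (rule S.add.subgroupI)
        fix a assume a: "a \<in> I"
        then have "a * (-1) \<in> I" using I V_closed by blast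
        moreover have "\<ominus>\<^bsub>sub_ring V\<^esub> a = - a"
          using a I S.minus_equality[of "- a" a] V_closed(3) by auto
        ultimately show "\<ominus>\<^bsub>sub_ring V\<^esub> a \<in> I" by simp
      qed (use I in auto)
    qed (use I S.ring_axioms in \<open>auto simp: mult.commute\<close>)
  qed
qed

text \<open>A valuation ring is local: every proper ideal consists of nonunits.\<close>

lemma maximalideal_iff_nonunits: "maximalideal P (sub_ring V) \<longleftrightarrow> P = nonunits V"
proof -
  have nonunits_ideal: "ideal (nonunits V) (sub_ring V)"
    unfolding sub_ring_ideal_iff
  proof (intro conjI ballI)
    show "nonunits V \<subseteq> V" by (auto simp: nonunits_def)
  qed (intro zero_nonunit nonunits_add nonunits_mult; assumption)+
  have proper: "J = V" if J: "ideal J (sub_ring V)" "\<not> J \<subseteq> nonunits V" for J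
  proof -
    obtain u where u: "u \<in> J" "is_unit_in V u"
      using J by (auto simp: sub_ring_ideal_iff nonunits_def)
    have "b \<in> J" if "b \<in> V" for b
    proof -
      have "inverse u * b \<in> V" using u(2) that by (auto simp: is_unit_in_def intro: V_closed)
      then have "u * (inverse u * b) \<in> J" using u(1) J(1) by (auto simp only: sub_ring_ideal_iff)
      then show ?thesis using u by (simp add: is_unit_in_def mult.assoc [symmetric])
    qed
    then show ?thesis using J by (auto simp: sub_ring_ideal_iff)
  qed
  show ?thesis
  proof
    assume "maximalideal P (sub_ring V)"
    then interpret P: maximalideal P "sub_ring V" .
    have "P \<subseteq> nonunits V"
      using proper[OF P.ideal_axioms] P.I_notcarr by auto
    then show "P = nonunits V"
      using P.I_maximal[OF nonunits_ideal] one_not_nonunit V_closed(1)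
      by (auto simp: nonunits_def)
  next
    assume P: "P = nonunits V"
    show "maximalideal P (sub_ring V)"
      unfolding P
    proof (rule maximalidealI[OF nonunits_ideal])
      show "carrier (sub_ring V) \<noteq> nonunits V" using one_not_nonunit V_closed(1) by auto
      show "J = nonunits V \<or> J = carrier (sub_ring V)"
        if "ideal J (sub_ring V)" "nonunits V \<subseteq> J" for J
        using proper[OF that(1)] that(2) by auto
    qed
  qed
qed

lemma mem_iff_inverse_nonunit: "z \<in> L \<Longrightarrow> z \<in> V \<longleftrightarrow> z = 0 \<or> inverse z \<notin> nonunits V"
  using not_mem_imp_inverse_nonunit[of z] V_closed(2) by (auto simp: nonunits_iff)

end

text \<open>All that is used of the field of a place, which is \<open>UNIV\<close> or \<open>K(x)\<close>.\<close>

definition mult_inverse_closed :: "'f::field set \<Rightarrow> bool" where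
  "mult_inverse_closed L \<longleftrightarrow> (\<forall>a\<in>L. \<forall>b\<in>L. a * b \<in> L) \<and> (\<forall>a\<in>L. inverse a \<in> L)"

lemma valuation_ring_imp_valuation_subring:
  "mult_inverse_closed L \<Longrightarrow> valuation_ring K L V \<Longrightarrow> valuation_subring L V"
  by unfold_locales (auto simp: valuation_ring_def subring_iff_is_subring mult_inverse_closed_def)

lemma places_eq_nonunits:
  assumes "mult_inverse_closed L"
  shows "places K L = nonunits ` {V. valuation_ring K L V}"
  using valuation_subring.maximalideal_iff_nonunits
    valuation_ring_imp_valuation_subring[OF assms]
  unfolding places_def by blast

text \<open>
  A nonzero element lies outside a valuation ring if and only if its inverse is a nonunit, so the
  nonunits determine the ring.
\<close>

lemma nonunits_inj:
  assumes L: "mult_inverse_closed L" and V: "valuation_ring K L V" and W: "valuation_ring K L W"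
    and eq: "nonunits V = nonunits W"
  shows "V = W"
proof -
  interpret V: valuation_subring L V by (rule valuation_ring_imp_valuation_subring[OF L V])
  interpret W: valuation_subring L W by (rule valuation_ring_imp_valuation_subring[OF L W])
  have "z \<in> V \<longleftrightarrow> z \<in> W" if "z \<in> L" for z
    using V.mem_iff_inverse_nonunit[OF that] W.mem_iff_inverse_nonunit[OF that] eq by simp
  then show ?thesis using V.subset W.subset by blast
qed

lemma place_ring_nonunits:
  assumes L: "mult_inverse_closed L" and V: "valuation_ring K L V"
  shows "place_ring K L (nonunits V) = V"
  unfolding place_ring_def
proof (rule the_equality)
  show "valuation_ring K L V \<and> maximalideal (nonunits V) (sub_ring V)"
    using V valuation_subring.maximalideal_iff_nonunits
      valuation_ring_imp_valuation_subring[OF L V] by blast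
next
  fix W assume W: "valuation_ring K L W \<and> maximalideal (nonunits V) (sub_ring W)"
  then have "nonunits V = nonunits W"
    using valuation_subring.maximalideal_iff_nonunits
      valuation_ring_imp_valuation_subring[OF L] by blast
  then show "W = V" using nonunits_inj[OF L V] W by blast
qed

context discrete_valuation_subring
begin

text \<open>
  The definition of the normalised valuation at a place refers to generators of the maximal ideal, so
  a uniformizer in the sense of values has to be one.
\<close>

lemma nonunits_principal: "nonunits V = {t * v | v. v \<in> V}"
proof
  show "{t * v | v. v \<in> V} \<subseteq> nonunits V" using nonunits_mult[OF t_nonunit] by auto
  show "nonunits V \<subseteq> {t * v | v. v \<in> V}"
  proof
    fix z assume z: "z \<in> nonunits V"
    show "z \<in> {t * v | v. v \<in> V}"
    proof (cases "z = 0")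
      case True
      then show ?thesis using V_closed(2) by force
    next
      case False
      then obtain n where n: "has_value V t n z"
        using has_value_ex z subset by (auto simp: nonunits_def)
      then have "n > 0" using z has_value_nonunit_iff by blast
      moreover have "has_value V t (n - 1) (z / t)"
        by (intro has_value_divide t_nz n has_value_self)
      ultimately have "z / t \<in> V" using has_value_mem_iff by force
      moreover have "z = t * (z / t)" using t_nz by simp
      ultimately show ?thesis by blast
    qed
  qed
qed

text \<open>
  Two generators of the maximal ideal differ by a unit, hence the value does not depend on the choice
  of the generator.
\<close>

lemma place_val_nonunits:
  assumes L: "mult_inverse_closed L" and V: "valuation_ring K L V"
    and z: "has_value V t n z"
  shows "place_val K L (nonunits V) z = n"
proof -
  have principal: "PIdl\<^bsub>sub_ring V\<^esub> a = {a * v | v. v \<in> V}" for a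
    by (auto simp: cgenideal_def mult.commute)
  have "\<exists>t\<in>V. \<exists>u\<in>Units (sub_ring V). nonunits V = PIdl\<^bsub>sub_ring V\<^esub> t \<and> z = t powi n * u"
    unfolding principal Units_sub_ring
    using z t_nonunit nonunits_principal by (auto simp: has_value_def nonunits_def)
  moreover have "n' = n"
    if t': "\<exists>t\<in>V. \<exists>u\<in>Units (sub_ring V). nonunits V = PIdl\<^bsub>sub_ring V\<^esub> t \<and> z = t powi n' * u"
    for n'
  proof -
    from t' obtain s u where s: "s \<in> V" "is_unit_in V u" "nonunits V = {s * v | v. v \<in> V}"
      "z = s powi n' * u"
      unfolding principal Units_sub_ring by auto
    obtain a where a: "a \<in> V" "t = s * a" using t_nonunit s(3) by auto
    have "s \<in> nonunits V" using s(3) V_closed(1) by force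
    then obtain b where b: "b \<in> V" "s = t * b" using nonunits_principal by auto
    have "t * (b * a) = t * 1" using a(2) b(2) by (metis mult.assoc mult.right_neutral)
    then have "b * a = 1" using t_nz by (simp only: mult_cancel_left) simp
    moreover from this have "inverse b = a" by (rule inverse_unique)
    ultimately have "is_unit_in V b"
      using a(1) b(1) by (auto simp: is_unit_in_def)
    then have "has_value V t n' z"
      unfolding has_value_def s(4) b(2)
      by (intro exI[of _ "b powi n' * u"])
        (auto simp: power_int_mult_distrib intro: unit_mult unit_powi s(2))
    then show ?thesis using z has_value_unique by blast
  qed
  ultimately show ?thesis
    unfolding place_val_def place_ring_nonunits[OF L V] Let_def by (intro the_equality)
qed

end

section \<open>Existence of valuation rings\<close>

definition adjoin :: "'f::field set \<Rightarrow> 'f \<Rightarrow> 'f set" where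
  "adjoin V z = {poly p z | p. \<forall>i. Polynomial.coeff p i \<in> V}"

lemma coeff_mult_mem:
  assumes "is_subring V" "\<forall>i. Polynomial.coeff p i \<in> V" "\<forall>i. Polynomial.coeff q i \<in> V"
  shows "Polynomial.coeff (p * q) i \<in> V"
  unfolding coeff_mult using assms by (intro is_subring_sum) (auto intro: is_subringD)

lemma adjoin_superset: "is_subring V \<Longrightarrow> V \<subseteq> adjoin V z"
proof
  fix v assume "is_subring V" "v \<in> V"
  then have "v = poly [:v:] z" "\<forall>i. Polynomial.coeff [:v:] i \<in> V"
    using is_subringD(2) by (auto simp: coeff_pCons split: nat.splits)
  then show "v \<in> adjoin V z" unfolding adjoin_def by blast
qed

lemma adjoin_subring:
  assumes V: "is_subring V"
  shows "is_subring (adjoin V z)"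
  unfolding is_subring_def
proof (intro conjI ballI)
  show "1 \<in> adjoin V z"
    using adjoin_superset[OF V] is_subringD(1)[OF V] by blast
next
  fix a b assume "a \<in> adjoin V z" "b \<in> adjoin V z"
  then obtain p q where pq: "a = poly p z" "b = poly q z"
    "\<forall>i. Polynomial.coeff p i \<in> V" "\<forall>i. Polynomial.coeff q i \<in> V"
    by (auto simp: adjoin_def)
  have "a - b = poly (p - q) z" "\<forall>i. Polynomial.coeff (p - q) i \<in> V"
    using pq is_subringD[OF V] by auto
  then show "a - b \<in> adjoin V z" unfolding adjoin_def by blast
  have "a * b = poly (p * q) z" "\<forall>i. Polynomial.coeff (p * q) i \<in> V"
    using pq coeff_mult_mem[OF V] by auto
  then show "a * b \<in> adjoin V z" unfolding adjoin_def by blast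
qed

lemma adjoin_mem: "is_subring V \<Longrightarrow> z \<in> adjoin V z"
proof -
  assume "is_subring V"
  then have "z = poly [:0, 1:] z" "\<forall>i. Polynomial.coeff [:0, 1:] i \<in> V"
    using is_subringD(1,2) by (auto simp: coeff_pCons split: nat.splits)
  then show ?thesis unfolding adjoin_def by blast
qed

text \<open>
  The degree reduction behind Chevalley's extension theorem: of two relations expressing \<open>1 / t\<close>
  through \<open>z\<close> and through \<open>1 / z\<close>, the shorter one lowers the degree of the longer one. The constant
  term \<open>q\<^sub>0\<close> of the shorter relation gives a factor \<open>1 - t q\<^sub>0\<close>, invertible by assumption, so that
  this relation expresses the top power of \<open>z\<close> by lower powers.
\<close>

lemma two_relations_reduce:
  fixes V :: "'f::field set"
  assumes V: "is_subring V" and t: "t \<in> V" and z: "z \<noteq> 0"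
    and unit: "\<And>v. v \<in> V \<Longrightarrow> 1 - t * v \<noteq> 0 \<and> inverse (1 - t * v) \<in> V"
    and p: "\<forall>i. Polynomial.coeff p i \<in> V" "t * poly p z = 1"
    and q: "\<forall>i. Polynomial.coeff q i \<in> V" "t * poly q (inverse z) = 1"
    and deg: "Polynomial.degree q \<le> Polynomial.degree p" "Polynomial.degree p > 0"
  shows "\<exists>p'. (\<forall>i. Polynomial.coeff p' i \<in> V) \<and> t * poly p' z = 1
           \<and> Polynomial.degree p' < Polynomial.degree p"
proof -
  obtain q0 q' where q': "q = pCons q0 q'" by (cases q)
  have q0: "q0 \<in> V" using q(1) q' by (auto dest: spec[of _ 0])
  have q'V: "\<forall>i. Polynomial.coeff q' i \<in> V"
  proof
    fix i show "Polynomial.coeff q' i \<in> V" using q(1)[rule_format, of "Suc i"] q' by simp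
  qed
  have "q' \<noteq> 0"
    using unit[OF q0] q(2) q' by auto
  define n where "n = Polynomial.degree p"
  define d where "d = Polynomial.degree q'"
  define c where "c = Polynomial.lead_coeff p"
  define s where "s = inverse (1 - t * q0)"
  define R where "R = Polynomial.monom 1 (n - 1 - d) * reflect_poly q'"
  have d: "d \<le> n - 1" using deg q' \<open>q' \<noteq> 0\<close> by (auto simp: d_def n_def)
  have n: "n > 0" using deg by (simp add: n_def)
  have "poly R z = z ^ (n - 1 - d) * z ^ d * poly q' (inverse z)"
    using poly_reflect_poly_nz[OF z, of q'] by (simp add: R_def poly_monom d_def)
  also have "\<dots> = z ^ (n - 1) * poly q' (inverse z)"
    using d by (simp only: power_add [symmetric] le_add_diff_inverse2)
  finally have R: "poly R z = z ^ (n - 1) * poly q' (inverse z)" .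
  have "t * poly q' (inverse z) = (1 - t * q0) * z"
    using q(2) q' z by (simp add: field_simps)
  then have "t * poly R z = z ^ (n - 1) * ((1 - t * q0) * z)"
    using R by (metis mult.left_commute)
  also have "\<dots> = (1 - t * q0) * z ^ n"
    using n by (cases n) auto
  finally have "s * (t * poly R z) = z ^ n"
    using unit[OF q0] by (simp add: s_def)
  then have zn: "z ^ n = s * t * poly R z" by (simp add: mult.assoc)
  define p' where "p' = p - Polynomial.monom c n + Polynomial.smult (c * s * t) R"
  have "poly p' z = poly p z - c * z ^ n + c * (s * t * poly R z)"
    by (simp add: p'_def poly_monom mult.assoc)
  then have 1: "t * poly p' z = 1"
    using p(2) by (simp flip: zn)
  have degR: "Polynomial.degree R \<le> n - 1"
    unfolding R_def using d degree_reflect_poly_le[of q']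
    by (intro order.trans[OF degree_mult_le]) (auto simp: degree_monom_eq d_def)
  have "Polynomial.coeff p' i = 0" if "i \<ge> n" for i
    using that degR n
    by (cases "i = n") (auto simp: p'_def c_def n_def coeff_eq_0)
  then have "Polynomial.degree p' \<le> n - 1" using n by (intro degree_le) auto
  then have 2: "Polynomial.degree p' < Polynomial.degree p" using n by (simp add: n_def)
  have "Polynomial.coeff R i \<in> V" for i
    unfolding R_def using q'V is_subringD(1,2)[OF V]
    by (intro coeff_mult_mem V) (auto simp: coeff_reflect_poly)
  moreover have "s \<in> V" using unit[OF q0] by (simp add: s_def)
  moreover have "c \<in> V" using p(1) by (simp add: c_def)
  ultimately have "\<forall>i. Polynomial.coeff p' i \<in> V"
    using p(1) t by (auto simp: p'_def intro!: is_subringD[OF V])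
  with 1 2 show ?thesis by blast
qed

lemma inverse_mem_of_two_relations:
  fixes V :: "'f::field set"
  assumes V: "is_subring V" and t: "t \<in> V" and z: "z \<noteq> 0"
    and unit: "\<And>v. v \<in> V \<Longrightarrow> 1 - t * v \<noteq> 0 \<and> inverse (1 - t * v) \<in> V"
    and p: "\<forall>i. Polynomial.coeff p i \<in> V" "t * poly p z = 1"
    and q: "\<forall>i. Polynomial.coeff q i \<in> V" "t * poly q (inverse z) = 1"
  shows "inverse t \<in> V"
  using p q
proof (induction "Polynomial.degree p + Polynomial.degree q" arbitrary: p q rule: less_induct)
  case less
  note p = less.prems(1,2) and q = less.prems(3,4)
  consider "Polynomial.degree p = 0" | "Polynomial.degree q = 0"
    | "Polynomial.degree q \<le> Polynomial.degree p" "Polynomial.degree p > 0"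
    | "Polynomial.degree p \<le> Polynomial.degree q" "Polynomial.degree q > 0"
    by linarith
  then show ?case
  proof cases
    case 1
    then obtain a where "p = [:a:]" by (auto elim: degree_eq_zeroE)
    then have "a \<in> V" "t * a = 1" using p by (auto dest: spec[of _ 0])
    then show ?thesis using inverse_unique[of t a] by simp
  next
    case 2
    then obtain a where "q = [:a:]" by (auto elim: degree_eq_zeroE)
    then have "a \<in> V" "t * a = 1" using q by (auto dest: spec[of _ 0])
    then show ?thesis using inverse_unique[of t a] by simp
  next
    case 3
    from two_relations_reduce[OF V t z unit p q 3] obtain p'
      where "\<forall>i. Polynomial.coeff p' i \<in> V" "t * poly p' z = 1"
        "Polynomial.degree p' < Polynomial.degree p" by blast
    then show ?thesis using less.hyps[of p' q] q by simp
  next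
    case 4
    have "inverse z \<noteq> 0" "t * poly p (inverse (inverse z)) = 1" using z p by auto
    from two_relations_reduce[OF V t this(1) unit q p(1) this(2) 4] obtain q'
      where "\<forall>i. Polynomial.coeff q' i \<in> V" "t * poly q' (inverse z) = 1"
        "Polynomial.degree q' < Polynomial.degree q" by blast
    then show ?thesis using less.hyps[of p q'] p by simp
  qed
qed

text \<open>
  Chevalley's extension theorem for the principal ideal generated by \<open>t\<close>, which is proper if and only
  if \<open>1 / t\<close> is not in the ring. A subring \<open>V\<close> that is maximal among those avoiding \<open>1 / t\<close> is a valuation
  ring: if neither \<open>z\<close> nor \<open>1 / z\<close> is in \<open>V\<close>, then adjoining either of them produces \<open>1 / t\<close>, which is the
  situation of the preceding lemma.
\<close>

theorem valuation_subring_exists: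
  fixes A :: "'f::field set"
  assumes A: "is_subring A" and t: "t \<in> A" "t \<noteq> 0" "inverse t \<notin> A"
  obtains V where "valuation_subring UNIV V" "A \<subseteq> V" "t \<in> nonunits V"
proof -
  define S where "S = {B. is_subring B \<and> A \<subseteq> B \<and> inverse t \<notin> B}"
  have "\<exists>M\<in>S. \<forall>Y\<in>S. M \<subseteq> Y \<longrightarrow> Y = M"
  proof (rule subset_Zorn_nonempty)
    show "S \<noteq> {}" using A t by (auto simp: S_def)
    fix C assume C: "C \<noteq> {}" "subset.chain S C"
    have CS: "B \<in> C \<Longrightarrow> B \<in> S" for B using C by (auto simp: subset_chain_def)
    have two: "\<exists>B\<in>C. a \<in> B \<and> b \<in> B" if "a \<in> \<Union>C" "b \<in> \<Union>C" for a b
      using that C(2) unfolding subset_chain_def by blast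
    have "is_subring (\<Union>C)"
      unfolding is_subring_def
    proof (intro conjI ballI)
      from C(1) obtain B where "B \<in> C" by blast
      then show "1 \<in> \<Union>C" using CS[of B] is_subringD(1)[of B] by (auto simp: S_def)
    next
      fix a b assume "a \<in> \<Union>C" "b \<in> \<Union>C"
      then obtain B where B: "B \<in> C" "a \<in> B" "b \<in> B" using two by blast
      then have "is_subring B" using CS by (auto simp: S_def)
      then show "a - b \<in> \<Union>C" "a * b \<in> \<Union>C"
        using B is_subringD(4,6)[of B a b] by blast+
    qed
    moreover from C(1) obtain B where "B \<in> C" by blast
    then have "A \<subseteq> \<Union>C" using CS[of B] by (auto simp: S_def)
    moreover have "inverse t \<notin> \<Union>C" using CS by (auto simp: S_def)
    ultimately show "\<Union>C \<in> S" by (simp add: S_def)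
  qed
  then obtain V where V: "V \<in> S" and max: "\<And>Y. Y \<in> S \<Longrightarrow> V \<subseteq> Y \<Longrightarrow> Y = V" by blast
  have sub: "is_subring V" "A \<subseteq> V" "inverse t \<notin> V" using V by (auto simp: S_def)
  have tV: "t \<in> V" using t sub by blast
  note cl = is_subringD[OF sub(1)]
  have relation: "\<exists>p. (\<forall>i. Polynomial.coeff p i \<in> V) \<and> t * poly p z = 1" if "z \<notin> V" for z
  proof -
    have "adjoin V z \<notin> S"
      using max[OF _ adjoin_superset[OF sub(1)], of z] adjoin_mem[OF sub(1), of z] that by metis
    then have "inverse t \<in> adjoin V z"
      using adjoin_subring[OF sub(1)] adjoin_superset[OF sub(1), of z] sub(2) by (auto simp: S_def)
    then obtain p where "\<forall>i. Polynomial.coeff p i \<in> V" "inverse t = poly p z"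
      by (auto simp: adjoin_def)
    then show ?thesis using t(2) by (metis right_inverse)
  qed
  have unit: "1 - t * v \<noteq> 0 \<and> inverse (1 - t * v) \<in> V" if v: "v \<in> V" for v
  proof -
    define e where "e = 1 - t * v"
    have e: "e \<noteq> 0"
    proof
      assume "e = 0"
      then have "t * v = 1" by (simp add: e_def)
      then have "inverse t = v" by (rule inverse_unique)
      then show False using v sub(3) by simp
    qed
    have "inverse e \<in> V"
    proof (rule ccontr)
      assume "inverse e \<notin> V"
      from relation[OF this] obtain p
        where p: "\<forall>i. Polynomial.coeff p i \<in> V" "t * poly p (inverse e) = 1" by blast
      define n where "n = Polynomial.degree p"
      (* clearing denominators turns the relation for 1 / e into one for e itself *)
      have "t * poly (reflect_poly p) e = e ^ n"
        using p(2) e by (simp add: poly_reflect_poly_nz n_def mult.left_commute)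
      moreover have "poly (reflect_poly p) e \<in> V"
        unfolding poly_altdef using p(1) v tV
        by (intro is_subring_sum sub(1)) (auto simp: coeff_reflect_poly e_def intro!: cl)
      moreover have "\<exists>v'\<in>V. e ^ k = 1 - t * v'" for k
      proof (induction k)
        case 0
        show ?case using cl(2) by (intro bexI[of _ 0]) auto
      next
        case (Suc k)
        then obtain v' where v': "v' \<in> V" "e ^ k = 1 - t * v'" by blast
        have "e ^ Suc k = (1 - t * v) * (1 - t * v')" using v' by (simp add: e_def)
        also have "\<dots> = 1 - t * (v' + v - t * v * v')" by (simp add: algebra_simps)
        finally have "e ^ Suc k = 1 - t * (v' + v - t * v * v')" .
        then show ?case using v v' tV by (intro bexI[of _ "v' + v - t * v * v'"]) (auto intro!: cl)
      qed
      ultimately obtain a b where "a \<in> V" "b \<in> V" "t * a = 1 - t * b" by metis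
      then have "t * (a + b) = 1" by (simp add: algebra_simps)
      then have "inverse t = a + b" by (rule inverse_unique)
      then show False using \<open>a \<in> V\<close> \<open>b \<in> V\<close> cl sub(3) by auto
    qed
    then show ?thesis using e by (simp add: e_def)
  qed
  have val: "z \<in> V \<or> inverse z \<in> V" for z
  proof (rule ccontr)
    assume z: "\<not> (z \<in> V \<or> inverse z \<in> V)"
    then have "z \<noteq> 0" using cl(2) by auto
    then have "inverse t \<in> V"
      using relation[of z] relation[of "inverse z"] z
        inverse_mem_of_two_relations[OF sub(1) tV _ unit] by blast
    then show False using sub(3) by blast
  qed
  interpret valuation_subring UNIV V
    using sub(1) val by unfold_locales auto
  have "t \<in> nonunits V" using tV sub(3) by (simp add: nonunits_iff)
  then show ?thesis using that[OF valuation_subring_axioms sub(2)] by blast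
qed

section \<open>Evaluating polynomials along a ring homomorphism\<close>

locale evaluation =
  fixes h :: "'a::comm_ring_1 \<Rightarrow> 'b::comm_ring_1" and c :: 'b
  assumes h_1: "h 1 = 1" and h_add: "h (a + b) = h a + h b" and h_mult: "h (a * b) = h a * h b"
begin

lemma h_0: "h 0 = 0" using h_add[of 0 0] by simp

lemma h_minus: "h (- a) = - h a" using h_add[of a "- a"] h_0 by (simp add: eq_neg_iff_add_eq_0 add.commute)

lemma h_diff: "h (a - b) = h a - h b" using h_add[of a "- b"] h_minus by simp

definition eval :: "'a poly \<Rightarrow> 'b" where "eval p = poly (map_poly h p) c"

lemma eval_0 [simp]: "eval 0 = 0" by (simp add: eval_def)

lemma eval_pCons [simp]: "eval (pCons a p) = h a + c * eval p"
  by (simp add: eval_def map_poly_pCons h_0)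

lemma eval_1 [simp]: "eval 1 = 1"
  using eval_pCons[of 1 0] by (simp add: h_1 one_pCons)

lemma eval_add: "eval (p + q) = eval p + eval q"
  by (induction p q rule: poly_induct2) (auto simp: h_add algebra_simps)

lemma eval_smult: "eval (Polynomial.smult a p) = h a * eval p"
  by (induction p) (auto simp: h_mult algebra_simps)

lemma eval_mult: "eval (p * q) = eval p * eval q"
  by (induction p) (auto simp: eval_add eval_smult h_0 algebra_simps)

lemma eval_minus: "eval (- p) = - eval p"
  using eval_smult[of "-1" p] by (simp add: h_minus h_1)

lemma eval_diff: "eval (p - q) = eval p - eval q"
  using eval_add[of p "- q"] by (simp add: eval_minus)

lemma eval_power: "eval (p ^ n) = eval p ^ n"
  by (induction n) (auto simp: eval_mult)

lemma eval_sum: "eval (sum g I) = (\<Sum>i\<in>I. eval (g i))"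
  by (induction I rule: infinite_finite_induct) (auto simp: eval_add)

lemma eval_prod: "eval (prod g I) = (\<Prod>i\<in>I. eval (g i))"
  by (induction I rule: infinite_finite_induct) (auto simp: eval_mult)

lemma eval_monom: "eval (Polynomial.monom a n) = h a * c ^ n"
  by (induction n) (auto simp: monom_0 monom_Suc h_0 algebra_simps)

lemma eval_as_sum: "eval p = (\<Sum>i\<le>Polynomial.degree p. h (Polynomial.coeff p i) * c ^ i)"
  by (subst (1) poly_as_sum_of_monoms[of p, symmetric]) (simp only: eval_sum eval_monom)

end

section \<open>Polynomial expressions in a valuation ring\<close>

locale valued_evaluation = valuation_subring L V + evaluation h c
  for L V :: "'f::field set" and h :: "'k::alg_closed_field \<Rightarrow> 'f" and c :: 'f +
  assumes constants: "range h \<subseteq> V"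
begin

lemma const_mem: "h a \<in> V" using constants by blast

lemma const_unit: "a \<noteq> 0 \<Longrightarrow> is_unit_in V (h a)"
proof -
  assume "a \<noteq> 0"
  then have 1: "h a * h (inverse a) = 1" by (simp flip: h_mult add: h_1)
  then have "inverse (h a) = h (inverse a)" by (rule inverse_unique)
  then show ?thesis using 1 const_mem by (auto simp: is_unit_in_def)
qed

lemma const_nonunit_iff: "h a \<in> nonunits V \<longleftrightarrow> a = 0"
  using const_unit unit_not_nonunit h_0 zero_nonunit by metis

lemma eval_mem: "c \<in> V \<Longrightarrow> eval p \<in> V"
  by (induction p) (auto intro!: V_closed const_mem)

context
  fixes a
  assumes near: "c - h a \<in> nonunits V"
begin

lemma near_mem: "c \<in> V"
  using near const_mem[of a] V_closed(5)[of "c - h a" "h a"] by (simp add: nonunits_iff)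

lemma eval_congruent: "eval p - h (poly p a) \<in> nonunits V"
proof (induction p)
  case 0
  then show ?case by (simp add: h_0 zero_nonunit)
next
  case (pCons b p)
  have "eval (pCons b p) - h (poly (pCons b p) a) =
      c * (eval p - h (poly p a)) + (c - h a) * h (poly p a)"
    by (simp add: h_add h_mult algebra_simps)
  also have "\<dots> \<in> nonunits V"
    by (intro nonunits_add nonunits_mult nonunits_mult' pCons near near_mem const_mem)
  finally show ?case .
qed

lemma eval_nonunit_iff: "eval p \<in> nonunits V \<longleftrightarrow> poly p a = 0"
proof
  assume "eval p \<in> nonunits V"
  then have "eval p - (eval p - h (poly p a)) \<in> nonunits V"
    by (intro nonunits_diff eval_congruent)
  then show "poly p a = 0" by (simp add: const_nonunit_iff)
next
  assume "poly p a = 0"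
  then show "eval p \<in> nonunits V" using eval_congruent[of p] by (simp add: h_0)
qed

lemma eval_unit: "poly p a \<noteq> 0 \<Longrightarrow> is_unit_in V (eval p)"
  using eval_nonunit_iff unit_or_nonunit eval_mem[OF near_mem] by blast

lemma near_unique: "c - h b \<in> nonunits V \<Longrightarrow> b = a"
  using eval_nonunit_iff[of "[:- b, 1:]"] by (simp add: h_minus h_1)

lemma eval_order: "p \<noteq> 0 \<Longrightarrow> \<exists>u. is_unit_in V u \<and> eval p = (c - h a) ^ Polynomial.order a p * u"
proof -
  assume "p \<noteq> 0"
  from order_decomp[OF this, of a] obtain q
    where q: "p = [:- a, 1:] ^ Polynomial.order a p * q" "\<not> [:- a, 1:] dvd q" by blast
  have "eval p = (c - h a) ^ Polynomial.order a p * eval q"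
    by (subst q(1)) (simp add: eval_mult eval_power h_minus h_1)
  moreover have "is_unit_in V (eval q)"
    using q(2) by (intro eval_unit) (simp add: poly_eq_0_iff_dvd)
  ultimately show ?thesis by blast
qed

end

text \<open>
  Over an algebraically closed field of constants every nonunit value of a polynomial comes from
  a root: the nonunits form a prime ideal and the polynomial splits into linear factors.
\<close>

lemma eval_nonunit_imp_near_root:
  assumes "c \<in> V" "eval p \<in> nonunits V" "p \<noteq> 0"
  shows "\<exists>a. poly p a = 0 \<and> c - h a \<in> nonunits V"
  using assms(2,3)
proof (induction "Polynomial.degree p" arbitrary: p rule: less_induct)
  case less
  show ?case
  proof (cases "Polynomial.degree p = 0")
    case True
    then obtain b where b: "p = [:b:]" by (auto elim: degree_eq_zeroE)
    then have "is_unit_in V (eval p)" using less.prems const_unit[of b] by simp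
    then show ?thesis using less.prems unit_not_nonunit by blast
  next
    case False
    then obtain a where a: "poly p a = 0" using alg_closed_imp_poly_has_root[of p] by auto
    then obtain q where q: "p = [:- a, 1:] * q" by (auto simp: poly_eq_0_iff_dvd)
    then have q0: "q \<noteq> 0" using less.prems by auto
    have "eval p = (c - h a) * eval q"
      by (simp add: q eval_diff eval_smult h_0 algebra_simps)
    then have "(c - h a) * eval q \<in> nonunits V" using less.prems by simp
    then consider "c - h a \<in> nonunits V" | "eval q \<in> nonunits V"
      using nonunits_prime eval_mem[OF assms(1)] assms(1) const_mem V_closed(4) by blast
    then show ?thesis
    proof cases
      case 2
      have "Polynomial.degree p = 1 + Polynomial.degree q"
        unfolding q using q0 by (subst degree_mult_eq) auto
      then obtain b where "poly q b = 0" "c - h b \<in> nonunits V" using less.hyps[OF _ 2 q0] by auto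
      then show ?thesis by (auto simp: q)
    qed (use a in blast)
  qed
qed

text \<open>
  If \<open>c\<close> has a pole, the leading term of a polynomial in \<open>c\<close> dominates: after division by the top power
  of \<open>c\<close> it becomes the reflected polynomial in the nonunit \<open>1 / c\<close>.
\<close>

lemma eval_infinite:
  assumes c: "c \<in> L" "c \<notin> V" and p: "p \<noteq> 0"
  shows "\<exists>u. is_unit_in V u \<and> eval p = c ^ Polynomial.degree p * u"
proof -
  have c0: "c \<noteq> 0" using c V_closed(2) by auto
  interpret I: valued_evaluation L V h "inverse c"
    by unfold_locales (rule constants)
  have h0: "h a = 0 \<longleftrightarrow> a = 0" for a
    using const_unit[of a] h_0 by (auto simp: is_unit_in_def)
  have "inverse c - h 0 \<in> nonunits V"
    using not_mem_imp_inverse_nonunit[OF c] by (simp add: h_0)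
  from I.eval_unit[OF this, of "reflect_poly p"]
  have u: "is_unit_in V (I.eval (reflect_poly p))"
    using p by (simp add: poly_0_coeff_0)
  have deg: "Polynomial.degree (map_poly h p) = Polynomial.degree p"
    using p h0 by (intro degree_map_poly) auto
  have "map_poly h (reflect_poly p) = reflect_poly (map_poly h p)"
    by (rule poly_eqI) (auto simp: coeff_map_poly coeff_reflect_poly deg h_0)
  then have "I.eval (reflect_poly p) = inverse c ^ Polynomial.degree p * eval p"
    using c0 by (simp add: I.eval_def eval_def poly_reflect_poly_nz deg)
  then have "eval p = c ^ Polynomial.degree p * I.eval (reflect_poly p)"
    using c0 by (simp add: field_simps)
  then show ?thesis using u by blast
qed

end

section \<open>The curve \<open>w ^ m = f(x)\<close>\<close>

locale superelliptic =
  fixes emb :: "'k::alg_closed_field \<Rightarrow> 'f::field"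
    and x w :: 'f and f :: "'k poly" and m r :: nat
  assumes emb_1: "emb 1 = 1"
    and emb_add: "emb (a + b) = emb a + emb b"
    and emb_mult: "emb (a * b) = emb a * emb b"
    and transcendental: "poly (map_poly emb p) x = 0 \<Longrightarrow> p = 0"
    and generated: "generate_field ring_of_type_algebra (range emb \<union> {x, w}) = UNIV"
    and equation: "w ^ m = poly (map_poly emb f) x"
    and m_ge_2: "m \<ge> 2"
    and degree_f: "Polynomial.degree f = r"
    and coprime_m_r: "coprime m r"
    and squarefree: "rsquarefree f"
    and m_nonzero: "of_nat m \<noteq> (0 :: 'k)"
begin

sublocale X: evaluation emb x
  by unfold_locales (fact emb_1 emb_add emb_mult)+

text \<open>\<open>W.eval G\<close> is the value \<open>G(x, w)\<close> of a polynomial in \<open>w\<close> whose coefficients are polynomials in \<open>x\<close>.\<close>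

sublocale W: evaluation X.eval w
  by unfold_locales (simp_all add: X.eval_add X.eval_mult)

lemma X_eval_eq_0_iff: "X.eval p = 0 \<longleftrightarrow> p = 0"
  using transcendental[of p] by (auto simp: X.eval_def)

lemma f_nz: "f \<noteq> 0" using squarefree by (auto simp: rsquarefree_def)

lemma w_power: "w ^ m = X.eval f" by (simp add: equation X.eval_def)

lemma x_nz: "x \<noteq> 0"
  using X_eval_eq_0_iff[of "[:0, 1:]"] by (auto simp: X.h_0 X.h_1)

lemma w_nz: "w \<noteq> 0"
  using w_power X_eval_eq_0_iff[of f] f_nz m_ge_2 by (auto simp: power_0_left)

lemma x_minus_const_nz: "x - emb a \<noteq> 0"
  using X_eval_eq_0_iff[of "[:- a, 1:]"] by (auto simp: X.h_minus X.h_1)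

end

text \<open>
  The common form of total ramification over infinity, where \<open>\<nu> = - deg\<close> and \<open>s = - r\<close>, and over a zero
  of \<open>f\<close>, where \<open>\<nu>\<close> is the order of vanishing and \<open>s = 1\<close>. Modulo \<open>m\<close> the value of a term \<open>p(x) w\<^sup>j\<close>
  is \<open>s j\<close>, which determines \<open>j < m\<close> because \<open>s\<close> is coprime to \<open>m\<close>.
\<close>

locale monomial_place = superelliptic emb x w f m r + uniformized UNIV V t
  for emb :: "'k::alg_closed_field \<Rightarrow> 'f::field" and x w f m r V t +
  fixes \<nu> :: "'k poly \<Rightarrow> int" and s :: int
  assumes value_poly: "p \<noteq> 0 \<Longrightarrow> has_value V t (int m * \<nu> p) (X.eval p)"
    and value_w: "has_value V t s w"
    and coprime_s: "coprime s (int m)"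
begin

lemma value_monomial: "p \<noteq> 0 \<Longrightarrow> has_value V t (int m * \<nu> p + s * int j) (X.eval p * w ^ j)"
  using has_value_mult[OF t_nz value_poly has_value_power[OF t_nz value_w], of p j]
  by (simp add: mult.commute)

text \<open>
  The terms \<open>p\<^sub>j(x) w\<^sup>j\<close> have distinct values, so the least one is the value of the sum.
\<close>

lemma value_reduced:
  assumes G: "G \<noteq> 0" "Polynomial.degree G < m"
  shows "\<exists>j. Polynomial.coeff G j \<noteq> 0
    \<and> has_value V t (int m * \<nu> (Polynomial.coeff G j) + s * int j) (W.eval G)
    \<and> (\<forall>i. Polynomial.coeff G i \<noteq> 0 \<longrightarrow> int m * \<nu> (Polynomial.coeff G j) + s * int j
                                     \<le> int m * \<nu> (Polynomial.coeff G i) + s * int i)"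
proof -
  define J where "J = {j. Polynomial.coeff G j \<noteq> 0}"
  let ?n = "\<lambda>j. int m * \<nu> (Polynomial.coeff G j) + s * int j"
  have J: "J \<subseteq> {..Polynomial.degree G}" by (auto simp: J_def intro: le_degree)
  then have fin: "finite J" using finite_subset by blast
  have ne: "J \<noteq> {}" using G(1) by (auto simp: J_def poly_eq_iff)
  have inj: "inj_on ?n J"
  proof (rule inj_onI)
    fix i j assume ij: "i \<in> J" "j \<in> J" "?n i = ?n j"
    then have "s * (int i - int j) = int m * (\<nu> (Polynomial.coeff G j) - \<nu> (Polynomial.coeff G i))"
      by (simp add: algebra_simps)
    then have "int m dvd s * (int i - int j)" by simp
    then have "int m dvd int i - int j"
      using coprime_s by (simp add: coprime_dvd_mult_right_iff coprime_commute)
    moreover have "i < m" "j < m" using ij J G(2) by fastforce+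
    then have "\<bar>int i - int j\<bar> < int m" by linarith
    ultimately show "i = j" using dvd_imp_le_int[of "int i - int j" "int m"] by auto
  qed
  have "W.eval G = (\<Sum>j\<in>J. X.eval (Polynomial.coeff G j) * w ^ j)"
    unfolding W.eval_as_sum using J by (intro sum.mono_neutral_right) (auto simp: J_def)
  then show ?thesis
    using has_value_sum_distinct[OF fin ne _ inj, of "\<lambda>j. X.eval (Polynomial.coeff G j) * w ^ j"]
      value_monomial
    by (auto simp: J_def)
qed

lemma value_quotient:
  assumes G: "G \<noteq> 0" "Polynomial.degree G < m" and D: "D \<noteq> 0"
  shows "\<exists>j. Polynomial.coeff G j \<noteq> 0
    \<and> has_value V t (int m * \<nu> (Polynomial.coeff G j) + s * int j - int m * \<nu> D) (W.eval G / X.eval D)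
    \<and> (\<forall>i. Polynomial.coeff G i \<noteq> 0 \<longrightarrow> int m * \<nu> (Polynomial.coeff G j) + s * int j
                                     \<le> int m * \<nu> (Polynomial.coeff G i) + s * int i)"
  using value_reduced[OF G] has_value_divide[OF t_nz _ value_poly[OF D]] by blast

text \<open>The right-hand side does not mention \<open>V\<close>; this is how uniqueness of \<open>V\<close> is obtained.\<close>

lemma quotient_mem_iff:
  assumes G: "G \<noteq> 0" "Polynomial.degree G < m" and D: "D \<noteq> 0"
  shows "W.eval G / X.eval D \<in> V \<longleftrightarrow>
    (\<forall>i. Polynomial.coeff G i \<noteq> 0 \<longrightarrow> int m * \<nu> (Polynomial.coeff G i) + s * int i - int m * \<nu> D \<ge> 0)"
proof -
  obtain j where j: "Polynomial.coeff G j \<noteq> 0"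
    "has_value V t (int m * \<nu> (Polynomial.coeff G j) + s * int j - int m * \<nu> D) (W.eval G / X.eval D)"
    "\<And>i. Polynomial.coeff G i \<noteq> 0 \<Longrightarrow> int m * \<nu> (Polynomial.coeff G j) + s * int j
                                     \<le> int m * \<nu> (Polynomial.coeff G i) + s * int i"
    using value_quotient[OF assms] by blast
  show ?thesis
    unfolding has_value_mem_iff[OF j(2)] using j(1,3) by fastforce
qed

end

context superelliptic
begin

text \<open>
  Valuation rings are integrally closed, and \<open>w\<close> is integral over \<open>K[x]\<close>.
\<close>

lemma integral_mem:
  assumes "valuation_subring UNIV V" "range emb \<subseteq> V" "x \<in> V"
  shows "w \<in> V"
proof -
  interpret valued_evaluation UNIV V emb x
    using assms by (intro_locales) (auto simp: valued_evaluation_axioms_def valuation_subring_def)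
  show ?thesis
  proof (rule ccontr)
    assume "w \<notin> V"
    then have "inverse w \<in> nonunits V" using not_mem_imp_inverse_nonunit by simp
    moreover have "inverse w ^ (m - 1) * X.eval f \<in> V"
      using \<open>inverse w \<in> nonunits V\<close> eval_mem[OF assms(3)]
      by (auto simp: nonunits_iff intro!: V_closed)
    ultimately have "inverse w * (inverse w ^ (m - 1) * X.eval f) \<in> nonunits V"
      by (rule nonunits_mult)
    moreover have "inverse w * (inverse w ^ (m - 1) * X.eval f) = 1"
      using m_ge_2 w_nz by (cases m) (simp_all flip: w_power add: field_simps)
    ultimately show False using one_not_nonunit by simp
  qed
qed

text \<open>
  If \<open>x\<close> has a pole, then \<open>w\<^sup>m = x\<^sup>r u\<close> with a unit \<open>u\<close>, which forces the values of \<open>x\<close> and \<open>w\<close> to be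
  proportional to \<open>m\<close> and \<open>r\<close>. For \<open>a m + b r = 1\<close>, the element \<open>x\<^sup>a w\<^sup>b\<close> has a pole of order \<open>1\<close>.
\<close>

lemma infinite_monomial_place:
  assumes V: "valuation_subring UNIV V" "range emb \<subseteq> V" and x: "x \<notin> V"
  obtains t where "monomial_place emb x w f m r V t (\<lambda>p. - int (Polynomial.degree p)) (- int r)"
proof -
  interpret valued_evaluation UNIV V emb x
    using V by (intro_locales) (auto simp: valued_evaluation_axioms_def valuation_subring_def)
  obtain u where u: "is_unit_in V u" "w ^ m = x ^ r * u"
    using eval_infinite[of f] x f_nz w_power degree_f by auto
  have u0: "u \<noteq> 0" using u by (simp add: is_unit_in_def)
  obtain a b :: int where ab: "a * int m + b * int r = 1"
    using coprime_m_r bezout_int[of "int m" "int r"] by auto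
  define y where "y = x powi a * w powi b"
  define t where "t = inverse y"
  have y0: "y \<noteq> 0" using x_nz w_nz by (simp add: y_def)
  have t_powi: "t powi (- n) = y powi n" for n
    by (simp add: t_def power_int_minus power_int_inverse)
  have wm: "w powi (int m * c) = x powi (int r * c) * u powi c" for c
    using arg_cong[OF u(2), of "\<lambda>z. z powi c"] by (simp add: power_int_mult power_int_mult_distrib power_mult_distrib)
  have "y powi int m = x powi (a * int m) * w powi (int m * b)"
    by (simp add: y_def power_int_mult power_int_mult_distrib power_mult_distrib mult.commute[of "int m" b])
  also have "\<dots> = x powi (a * int m + b * int r) * u powi b"
    unfolding wm using x_nz by (simp add: power_int_add mult.commute)
  also have "\<dots> = x * u powi b" by (simp add: ab)
  finally have "x = y powi int m * u powi (- b)"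
    using u0 by (simp add: power_int_minus)
  then have x_val: "has_value V t (- int m) x"
    unfolding has_value_def using t_powi unit_powi[OF u(1), of "- b"] by auto
  have "y powi int r * u powi a = x powi (int r * a) * u powi a * w powi (b * int r)"
    by (simp add: y_def power_int_mult power_int_mult_distrib power_mult_distrib mult.commute[of "int r" a])
  also have "\<dots> = w powi (int m * a + b * int r)"
    unfolding wm [symmetric] using w_nz by (simp add: power_int_add)
  also have "\<dots> = w" using ab by (simp add: mult.commute)
  finally have "w = y powi int r * u powi a" ..
  then have w_val: "has_value V t (- int r) w"
    unfolding has_value_def using t_powi unit_powi[OF u(1), of a] by auto
  have "y \<notin> V"
  proof
    assume "y \<in> V"
    then have "y ^ m * u powi (- b) \<in> V"
      using unit_powi[OF u(1)] by (auto simp: is_unit_in_def intro!: V_closed)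
    then show False using x \<open>x = y powi int m * u powi (- b)\<close> by simp
  qed
  then have t: "t \<in> nonunits V" "t \<noteq> 0"
    using not_mem_imp_inverse_nonunit y0 by (auto simp: t_def)
  have "has_value V t (int m * - int (Polynomial.degree p)) (X.eval p)" if p: "p \<noteq> 0" for p
  proof -
    obtain v where "is_unit_in V v" "X.eval p = x ^ Polynomial.degree p * v"
      using eval_infinite[OF _ x p] by auto
    then show ?thesis
      using has_value_mult[OF t(2) has_value_power[OF t(2) x_val] has_value_unit, of v "Polynomial.degree p"]
      by (simp add: mult.commute)
  qed
  moreover have "coprime (- int r) (int m)" using coprime_m_r by (simp add: coprime_commute)
  ultimately have "monomial_place emb x w f m r V t (\<lambda>p. - int (Polynomial.degree p)) (- int r)"
    using t w_val by unfold_locales auto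
  then show ?thesis by (rule that)
qed

text \<open>
  The zero \<open>a\<close> of \<open>f\<close> is simple, so \<open>w\<^sup>m = f(x)\<close> is \<open>x - a\<close> up to a unit, and \<open>w\<close> is a uniformizer.
\<close>

lemma root_monomial_place:
  assumes V: "valuation_subring UNIV V" "range emb \<subseteq> V"
    and near: "x - emb a \<in> nonunits V" and root: "poly f a = 0"
  shows "monomial_place emb x w f m r V w (\<lambda>p. int (Polynomial.order a p)) 1"
proof -
  interpret valued_evaluation UNIV V emb x
    using V by (intro_locales) (auto simp: valued_evaluation_axioms_def valuation_subring_def)
  have "Polynomial.order a f = 1" using rsquarefree_root_order[OF squarefree root f_nz] .
  then obtain u where u: "is_unit_in V u" "w ^ m = (x - emb a) * u"
    using eval_order[OF near f_nz] w_power by auto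
  have "w \<in> V" using integral_mem[OF V] near_mem[OF near] by blast
  moreover have "w ^ m \<in> nonunits V"
    using u nonunits_mult[OF near] by (simp add: is_unit_in_def)
  ultimately have w: "w \<in> nonunits V" using nonunits_prime_power by blast
  have "x - emb a = w powi int m * inverse u"
    using u by (auto simp: is_unit_in_def)
  then have x_val: "has_value V w (int m) (x - emb a)"
    unfolding has_value_def using unit_inverse[OF u(1)] by blast
  have "has_value V w (int m * int (Polynomial.order a p)) (X.eval p)" if p: "p \<noteq> 0" for p
  proof -
    obtain v where "is_unit_in V v" "X.eval p = (x - emb a) ^ Polynomial.order a p * v"
      using eval_order[OF near p] by auto
    then show ?thesis
      using has_value_mult[OF w_nz has_value_power[OF w_nz x_val] has_value_unit, of v "Polynomial.order a p"]
      by (simp add: mult.commute)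
  qed
  then show ?thesis
    using w w_nz has_value_self by unfold_locales auto
qed

text \<open>
  The ring \<open>K[1 / x]\<close> does not contain \<open>x\<close>, as \<open>x\<close> is transcendental.
\<close>

lemma infinite_valuation_subring_exists:
  obtains V where "valuation_subring UNIV V" "range emb \<subseteq> V" "x \<notin> V"
proof -
  interpret I: evaluation emb "inverse x" by unfold_locales
  have "is_subring (range I.eval)"
    unfolding is_subring_def by (auto simp flip: I.eval_diff I.eval_mult intro: range_eqI[of _ _ 1])
  moreover have "inverse x \<in> range I.eval"
    by (rule range_eqI[of _ _ "[:0, 1:]"]) (simp add: X.h_0 X.h_1)
  moreover have "inverse (inverse x) \<notin> range I.eval"
  proof
    assume "inverse (inverse x) \<in> range I.eval"
    then obtain p where p: "x = I.eval p" by auto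
    define q where "q = reflect_poly (map_poly emb p)"
    define d where "d = Polynomial.degree (map_poly emb p)"
    have h0: "emb a = 0 \<longleftrightarrow> a = 0" for a
      using X_eval_eq_0_iff[of "[:a:]"] by (auto simp: X.h_0)
    have d: "d = Polynomial.degree p"
      unfolding d_def using h0 by (cases "p = 0") (auto intro!: degree_map_poly)
    have "map_poly emb (reflect_poly p) = q"
      unfolding q_def
      by (rule poly_eqI) (auto simp: coeff_map_poly coeff_reflect_poly X.h_0 d[unfolded d_def])
    then have "X.eval (reflect_poly p) = x ^ d * I.eval p"
      using x_nz by (simp add: X.eval_def I.eval_def poly_reflect_poly_nz q_def d_def)
    then have "X.eval (Polynomial.monom 1 (Suc d) - reflect_poly p) = 0"
      using p by (simp add: X.eval_diff X.eval_monom X.h_1)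
    then have "Polynomial.monom 1 (Suc d) = reflect_poly p"
      using X_eval_eq_0_iff by simp
    then have "Suc d = Polynomial.degree (reflect_poly p)"
      by (metis degree_monom_eq zero_neq_one)
    then show False using degree_reflect_poly_le[of p] d by simp
  qed
  ultimately obtain V where V: "valuation_subring UNIV V" "range I.eval \<subseteq> V"
    "inverse x \<in> nonunits V"
    using valuation_subring_exists[of "range I.eval" "inverse x"] x_nz by auto
  have "emb a \<in> range I.eval" for a by (rule range_eqI[of _ _ "[:a:]"]) simp
  then have "range emb \<subseteq> V" using V(2) by blast
  moreover have "x \<notin> V"
    using valuation_subring.nonunits_iff[OF V(1)] V(3) x_nz by auto
  ultimately show ?thesis using that V(1) by blast
qed

text \<open>
  A nonzero sum \<open>\<Sum>\<^sub>j p\<^sub>j(x) w\<^sup>j\<close> with \<open>j < m\<close> has a value at infinity. In other words, \<open>Y\<^sup>m - f\<close> is the minimal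
  polynomial of \<open>w\<close> over \<open>K(x)\<close>.
\<close>

lemma linear_independence:
  assumes "W.eval G = 0" "Polynomial.degree G < m"
  shows "G = 0"
proof (rule ccontr)
  assume G: "G \<noteq> 0"
  obtain V where "valuation_subring UNIV V" "range emb \<subseteq> V" "x \<notin> V"
    by (rule infinite_valuation_subring_exists)
  then obtain t where "monomial_place emb x w f m r V t (\<lambda>p. - int (Polynomial.degree p)) (- int r)"
    by (rule infinite_monomial_place)
  then interpret monomial_place emb x w f m r V t "\<lambda>p. - int (Polynomial.degree p)" "- int r" .
  show False using value_reduced[OF G assms(2)] has_value_nz assms(1) by blast
qed

end

section \<open>Separable binomials\<close>

lemma card_roots_rsquarefree:
  fixes p :: "'k::alg_closed_field poly"
  assumes "rsquarefree p"
  shows "card {a. poly p a = 0} = Polynomial.degree p"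
proof -
  have p: "p \<noteq> 0" using assms by (simp add: rsquarefree_def)
  obtain A where A: "size A = Polynomial.degree p"
    "p = Polynomial.smult (Polynomial.lead_coeff p) (\<Prod>a\<in>#A. [:- a, 1:])"
    using alg_closed_imp_factorization[OF p] by blast
  have "proots p = proots (\<Prod>a\<in>#A. [:- a, 1:])"
    using p by (subst A(2)) (simp del: lead_coeff_smult)
  also have "\<dots> = A"
  proof (induction A)
    case (add a A)
    have "(\<Prod>a\<in>#A. [:- a, 1:]) \<noteq> 0" by (auto simp: prod_mset_zero_iff)
    then have "[:- a, 1:] * (\<Prod>a\<in>#A. [:- a, 1:]) \<noteq> 0" by (subst mult_eq_0_iff) simp
    then have "proots ([:- a, 1:] * (\<Prod>a\<in>#A. [:- a, 1:])) = {#a#} + A"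
      by (subst proots_mult) (use add.IH in auto)
    then show ?case by (simp del: mult_pCons_left)
  qed simp
  finally have "size (proots p) = Polynomial.degree p" using A(1) by simp
  moreover have "size (proots p) = (\<Sum>a | poly p a = 0. Polynomial.order a p)"
    using p by (simp add: size_multiset_overloaded_eq)
  moreover have "\<dots> = (\<Sum>a | poly p a = 0. 1)"
    using rsquarefree_root_order[OF assms _ p] by (intro sum.cong) auto
  ultimately show ?thesis by simp
qed

lemma rsquarefree_binomial:
  assumes m: "of_nat m \<noteq> (0 :: 'k::field)" and c: "c \<noteq> 0"
  shows "rsquarefree (Polynomial.monom 1 m - [:c:] :: 'k poly)" (is "rsquarefree ?p")
proof -
  have m0: "m \<noteq> 0" using m by (intro notI) simp
  have p0: "?p \<noteq> 0"
  proof
    assume "?p = 0"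
    then have "Polynomial.coeff ?p m = 0" by simp
    then show False using m0 by (simp add: coeff_pCons split: nat.splits)
  qed
  have "Polynomial.order a ?p \<le> 1" for a
  proof (rule ccontr)
    assume "\<not> Polynomial.order a ?p \<le> 1"
    then have "[:- a, 1:] ^ 2 dvd ?p"
      by (intro dvd_trans[OF le_imp_power_dvd order_1]) simp
    then obtain q where q: "?p = [:- a, 1:] ^ 2 * q" by blast
    define u where "u = [:- a, 1:]"
    have u: "?p = u * (u * q)" "poly u a = 0"
      unfolding q u_def power2_eq_square by (rule mult.assoc) simp
    have "poly ?p a = 0" unfolding u(1) by (simp add: u(2))
    then have am: "a ^ m = c" by (simp add: poly_monom)
    have "poly (pderiv ?p) a = 0" unfolding u(1) by (simp add: pderiv_mult u(2))
    then have "of_nat m * a ^ (m - 1) = 0"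
      by (simp add: pderiv_diff pderiv_monom poly_monom pderiv_pCons)
    then have "a = 0" using m by simp
    then show False using am c m0 by (simp add: power_0_left)
  qed
  then have "Polynomial.order a ?p = 0 \<or> Polynomial.order a ?p = 1" for a
    using le_Suc_eq by auto
  then show ?thesis using p0 by (simp add: rsquarefree_def)
qed

lemma degree_binomial: "m > 0 \<Longrightarrow> Polynomial.degree (Polynomial.monom 1 m - [:c:]) = m"
  for c :: "'a::comm_ring_1"
proof -
  assume "m > 0"
  then have "Polynomial.degree (- [:c:]) < Polynomial.degree (Polynomial.monom (1::'a) m)"
    by (simp add: degree_monom_eq)
  then show ?thesis
    unfolding diff_conv_add_uminus by (subst degree_add_eq_left) (simp_all add: degree_monom_eq)
qed

lemma card_roots_binomial:
  assumes "of_nat m \<noteq> (0 :: 'k::alg_closed_field)" "c \<noteq> (0 :: 'k)"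
  shows "card {b. b ^ m = c} = m"
proof -
  have "m > 0" using assms(1) by (intro Nat.gr0I) auto
  then show ?thesis
    using card_roots_rsquarefree[OF rsquarefree_binomial[OF assms]] degree_binomial[of m c]
    by (simp add: poly_monom)
qed

lemma poly_zero_if_many_roots:
  fixes p :: "'k::field poly"
  assumes "\<And>b. b \<in> B \<Longrightarrow> poly p b = 0" "Polynomial.degree p < card B"
  shows "p = 0"
proof (rule ccontr)
  assume p: "p \<noteq> 0"
  have "card B \<le> card {b. poly p b = 0}"
    using assms(1) poly_roots_finite[OF p] by (intro card_mono) auto
  then show False using card_poly_roots_bound[OF p] assms(2) by linarith
qed

section \<open>The function field as a quotient\<close>

context superelliptic
begin

definition curve :: "'k poly poly" where "curve = Polynomial.monom 1 m - [:f:]"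

lemma degree_curve: "Polynomial.degree curve = m"
  unfolding curve_def using m_ge_2 by (intro degree_binomial) simp

lemma W_eval_curve: "W.eval curve = 0"
  by (simp add: curve_def W.eval_diff W.eval_monom w_power)

lemma curve_division: "\<exists>Q R. G = curve * Q + R \<and> Polynomial.degree R < m"
proof -
  obtain Q R where QR: "pseudo_divmod G curve = (Q, R)" by fastforce
  have lc: "Polynomial.lead_coeff curve = 1"
    unfolding degree_curve using m_ge_2 by (simp add: curve_def coeff_pCons split: nat.splits)
  then have "curve \<noteq> 0" by auto
  from pseudo_divmod[OF this QR] lc m_ge_2 show ?thesis
    by (intro exI[of _ Q] exI[of _ R]) (auto simp: degree_curve)
qed

lemma W_eval_reduced: "\<exists>R. W.eval G = W.eval R \<and> Polynomial.degree R < m"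
  using curve_division[of G] W_eval_curve by (metis W.eval_add W.eval_mult add_0 mult_zero_left)

lemma W_eval_eq_0_imp_dvd: "W.eval G = 0 \<Longrightarrow> curve dvd G"
proof -
  assume G: "W.eval G = 0"
  obtain Q R where QR: "G = curve * Q + R" "Polynomial.degree R < m" using curve_division by blast
  then have "W.eval R = 0" using G W_eval_curve by (simp add: W.eval_add W.eval_mult)
  then have "R = 0" using linear_independence QR(2) by blast
  then show ?thesis using QR(1) by simp
qed

text \<open>
  The norm of \<open>G(x, w)\<close> to \<open>K(x)\<close>, computed as the product of the conjugates \<open>G(x, c w)\<close> over the
  \<open>m\<close>-th roots of unity \<open>c\<close>. As a polynomial in \<open>w\<close> it is invariant under \<open>w \<mapsto> c w\<close>, hence involves
  only powers of \<open>w\<^sup>m\<close> and evaluates to a polynomial in \<open>x\<close>.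
\<close>

lemma norm_exists:
  assumes G: "G \<noteq> 0" "Polynomial.degree G < m"
  shows "\<exists>H N. N \<noteq> 0 \<and> W.eval G * W.eval H = X.eval N"
proof -
  define \<mu> where "\<mu> = {c :: 'k. c ^ m = 1}"
  have card: "card \<mu> = m" unfolding \<mu>_def using m_nonzero by (intro card_roots_binomial) auto
  then have fin: "finite \<mu>" using m_ge_2 by (intro card_ge_0_finite) simp
  define T where "T c = pcompose G [:0, [:c:]:]" for c
  define P where "P = prod T \<mu>"
  have T_nz: "W.eval (T c) \<noteq> 0" if "c \<in> \<mu>" for c
  proof
    assume "W.eval (T c) = 0"
    moreover have "Polynomial.degree (T c) < m"
    proof -
      have "Polynomial.degree (T c) \<le> Polynomial.degree G * Polynomial.degree [:0, [:c:]:]"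
        unfolding T_def by (rule degree_pcompose_le)
      also have "\<dots> \<le> Polynomial.degree G" by simp
      finally show ?thesis using G(2) by simp
    qed
    ultimately have "T c = 0" by (rule linear_independence)
    then have zero: "[:c:] ^ i * Polynomial.coeff G i = 0" for i
      by (simp flip: coeff_pcompose_linear add: T_def)
    have "c \<noteq> 0" using that m_ge_2 by (auto simp: \<mu>_def power_0_left)
    then have "[:c:] ^ i \<noteq> 0" for i by (intro power_not_zero) simp
    then have "Polynomial.coeff G i = 0" for i
      using zero[of i] by (simp only: mult_eq_0_iff) blast
    then have "G = 0" by (intro poly_eqI) simp
    then show False using G(1) by blast
  qed
  have invariant: "pcompose P [:0, [:d:]:] = P" if d: "d \<in> \<mu>" for d
  proof -
    have "pcompose (T c) [:0, [:d:]:] = T (c * d)" for c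
      unfolding T_def by (simp flip: pcompose_assoc add: pcompose_pCons mult.commute)
    then have "pcompose P [:0, [:d:]:] = (\<Prod>c\<in>\<mu>. T (c * d))"
      by (simp add: P_def pcompose_prod)
    also have "\<dots> = prod T \<mu>"
    proof (rule prod.reindex_bij_witness[of _ "\<lambda>c. c / d" "\<lambda>c. c * d"])
      have "d \<noteq> 0" using d m_ge_2 by (auto simp: \<mu>_def power_0_left)
      then show "c * d / d = c" "c / d * d = c" for c by auto
      show "c * d \<in> \<mu>" "c / d \<in> \<mu>" if "c \<in> \<mu>" for c
        using that d by (auto simp: \<mu>_def power_mult_distrib power_divide)
    qed auto
    finally show ?thesis by (simp add: P_def)
  qed
  have support: "m dvd n" if n: "Polynomial.coeff P n \<noteq> 0" for n
  proof (rule ccontr)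
    assume not_dvd: "\<not> m dvd n"
    define k where "k = n mod m"
    have k: "0 < k" "k < m" using not_dvd m_ge_2 by (auto simp: k_def mod_greater_zero_iff_not_dvd)
    have "d ^ k = 1" if d: "d \<in> \<mu>" for d
    proof -
      have "[:d:] ^ n * Polynomial.coeff P n = Polynomial.coeff P n"
        using arg_cong[OF invariant[OF d], of "\<lambda>p. Polynomial.coeff p n"]
        by (simp add: coeff_pcompose_linear)
      then have "[:d:] ^ n = 1" using n by simp
      then have "poly ([:d:] ^ n) 0 = poly 1 0" by simp
      then have "d ^ n = 1" by (simp add: poly_power)
      also have "d ^ n = (d ^ m) ^ (n div m) * d ^ k"
        by (simp flip: power_mult power_add add: k_def)
      finally show ?thesis using d by (simp add: \<mu>_def)
    qed
    (* all m roots of unity would be roots of a binomial of degree k < m *)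
    then have "Polynomial.monom 1 k - [:1:] = (0 :: 'k poly)"
      using k by (intro poly_zero_if_many_roots[of \<mu>]) (auto simp: poly_monom card degree_binomial)
    then show False using degree_binomial[OF k(1), of "1 :: 'k"] k by simp
  qed
  define N where
    "N = (\<Sum>n\<le>Polynomial.degree P. Polynomial.coeff P n * (if m dvd n then f ^ (n div m) else 0))"
  have "W.eval P = X.eval N"
    unfolding W.eval_as_sum N_def X.eval_sum
  proof (intro sum.cong refl)
    fix n
    show "X.eval (Polynomial.coeff P n) * w ^ n =
        X.eval (Polynomial.coeff P n * (if m dvd n then f ^ (n div m) else 0))"
    proof (cases "m dvd n")
      case True
      then have "w ^ n = X.eval f ^ (n div m)" by (simp flip: w_power power_mult)
      then show ?thesis using True by (simp add: X.eval_mult X.eval_power)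
    next
      case False
      then have "Polynomial.coeff P n = 0" using support by blast
      then show ?thesis by simp
    qed
  qed
  moreover have "W.eval P \<noteq> 0"
    using T_nz fin by (simp add: P_def W.eval_prod)
  moreover have "T 1 = G"
  proof -
    have "[:1:] = (1 :: 'k poly)" by (simp add: one_pCons)
    then show ?thesis by (simp only: T_def pcompose_idR)
  qed
  then have "P = G * prod T (\<mu> - {1})"
    using prod.remove[OF fin, of 1 T] by (simp add: P_def \<mu>_def)
  then have "W.eval P = W.eval G * W.eval (prod T (\<mu> - {1}))" by (simp add: W.eval_mult)
  ultimately have "N \<noteq> 0 \<and> W.eval G * W.eval (prod T (\<mu> - {1})) = X.eval N" by auto
  then show ?thesis by blast
qed

text \<open>
  The quotients are closed under inversion because \<open>1 / G(x, w) = H(x, w) / N(x)\<close>, where \<open>N\<close> is the norm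
  of \<open>G\<close> and \<open>H\<close> is the product of the other conjugates.
\<close>

theorem element_as_quotient:
  obtains G D where "Polynomial.degree G < m" "D \<noteq> 0" "z = W.eval G / X.eval D"
proof -
  define S where "S = {W.eval G / X.eval D | G D. D \<noteq> 0}"
  have S_intro: "W.eval G / X.eval D \<in> S" if "D \<noteq> 0" for G D
    using that unfolding S_def by blast
  have "z \<in> generate_field ring_of_type_algebra (range emb \<union> {x, w})" for z
    unfolding generated by simp
  then have "z \<in> S"
  proof (induction rule: generate_field.induct)
    case one
    show ?case using S_intro[of 1 1] by simp
  next
    case (incl z)
    then consider a where "z = emb a" | "z = x" | "z = w" by auto
    then show ?case
    proof cases
      case 1
      then show ?thesis using S_intro[of 1 "[:[:a:]:]"] by simp
    next
      case 2
      then show ?thesis using S_intro[of 1 "[:[:0, 1:]:]"] by (simp add: X.h_0 X.h_1)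
    next
      case 3
      then show ?thesis using S_intro[of 1 "[:0, 1:]"] by simp
    qed
  next
    case (a_inv z)
    then obtain G D where "D \<noteq> 0" "z = W.eval G / X.eval D" by (auto simp: S_def)
    then show ?case using S_intro[of D "- G"] by (simp add: W.eval_minus)
  next
    case (m_inv z)
    then obtain G' D where G': "D \<noteq> 0" "z = W.eval G' / X.eval D" by (auto simp: S_def)
    obtain G where G: "W.eval G' = W.eval G" "Polynomial.degree G < m" using W_eval_reduced by blast
    have z0: "z \<noteq> 0" using m_inv by simp
    then have "G \<noteq> 0" using G' G by auto
    then obtain H N where N: "N \<noteq> 0" "W.eval G * W.eval H = X.eval N"
      using norm_exists G(2) by blast
    have "inverse z = X.eval D / W.eval G" using G' G(1) by simp
    also have "\<dots> = W.eval ([:D:] * H) / X.eval N"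
    proof -
      have "W.eval G \<noteq> 0" "W.eval H \<noteq> 0" using z0 G' G(1) N X_eval_eq_0_iff[of N] by auto
      then show ?thesis by (simp add: W.eval_mult N(2) [symmetric] del: mult_pCons_left)
    qed
    finally show ?case using S_intro[OF N(1)] z0 by (simp add: m_inv_ring_of_type_algebra)
  next
    case (eng_add z z')
    then obtain G D G' D' where *: "D \<noteq> 0" "z = W.eval G / X.eval D"
      "D' \<noteq> 0" "z' = W.eval G' / X.eval D'" by (auto simp: S_def)
    then have "z + z' = W.eval (G * [:D':] + G' * [:D:]) / X.eval (D * D')"
      using X_eval_eq_0_iff by (simp add: W.eval_add W.eval_mult X.eval_mult add_frac_eq del: mult_pCons_right)
    then show ?case using S_intro[of "D * D'"] * by simp
  next
    case (eng_mult z z')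
    then obtain G D G' D' where *: "D \<noteq> 0" "z = W.eval G / X.eval D"
      "D' \<noteq> 0" "z' = W.eval G' / X.eval D'" by (auto simp: S_def)
    then have "z * z' = W.eval (G * G') / X.eval (D * D')"
      by (simp add: W.eval_mult X.eval_mult)
    then show ?case using S_intro[of "D * D'"] * by simp
  qed
  then obtain G' D where "D \<noteq> 0" "z = W.eval G' / X.eval D" by (auto simp: S_def)
  then show ?thesis using W_eval_reduced[of G'] that by metis
qed

end

section \<open>The places of the curve\<close>

lemma (in monomial_place) discrete: "discrete_valuation_subring UNIV V t"
proof
  fix z assume "z \<noteq> (0 :: 'f)"
  obtain G D where GD: "Polynomial.degree G < m" "D \<noteq> 0" "z = W.eval G / X.eval D"
    by (rule element_as_quotient)
  moreover from this \<open>z \<noteq> 0\<close> have "G \<noteq> 0" by auto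
  ultimately show "\<exists>n. has_value V t n z" using value_quotient by blast
qed

context superelliptic
begin

definition place_subring :: "'f set \<Rightarrow> bool" where
  "place_subring V \<longleftrightarrow> valuation_subring UNIV V \<and> range emb \<subseteq> V \<and> V \<noteq> UNIV"

lemma place_subring_valued_evaluation:
  "place_subring V \<Longrightarrow> valued_evaluation UNIV V emb"
  unfolding place_subring_def valued_evaluation_def valued_evaluation_axioms_def
  by (auto simp: evaluation_def emb_1 emb_add emb_mult)

lemma x_not_constant: "x \<noteq> emb a"
  using x_minus_const_nz[of a] by simp

lemma place_subring_iff: "place_subring V \<longleftrightarrow> valuation_ring (range emb) UNIV V"
proof
  assume V: "place_subring V"
  then interpret valued_evaluation UNIV V emb x by (rule place_subring_valued_evaluation)
  have "inverse x \<noteq> emb a" for a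
  proof
    assume a: "inverse x = emb a"
    then have "a \<noteq> 0" using x_nz X.h_0 by auto
    have "emb a * emb (inverse a) = 1"
      using \<open>a \<noteq> 0\<close> by (simp flip: emb_mult add: emb_1)
    then have "inverse (emb a) = emb (inverse a)" by (rule inverse_unique)
    then have "x = emb (inverse a)" using a by (metis inverse_inverse_eq)
    then show False using x_not_constant by blast
  qed
  then have "x \<notin> range emb" "inverse x \<notin> range emb" using x_not_constant by auto
  then have "V \<noteq> range emb" using valuation[of x] by auto
  then show "valuation_ring (range emb) UNIV V"
    using V subring valuation unfolding valuation_ring_def place_subring_def
    by (auto simp: subring_iff_is_subring)
next
  assume V: "valuation_ring (range emb) UNIV V"
  have "mult_inverse_closed (UNIV :: 'f set)" by (simp add: mult_inverse_closed_def)
  from valuation_ring_imp_valuation_subring[OF this V] V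
  show "place_subring V" by (auto simp: place_subring_def valuation_ring_def)
qed

lemma nonunit_nz_imp_place_subring:
  assumes "valuation_subring UNIV V" "range emb \<subseteq> V" "t \<in> nonunits V" "t \<noteq> 0"
  shows "place_subring V"
  using assms valuation_subring.nonunits_iff[OF assms(1)] by (auto simp: place_subring_def)

lemma W_eval_mem:
  assumes V: "place_subring V" and x: "x \<in> V"
  shows "W.eval G \<in> V"
proof -
  interpret valued_evaluation UNIV V emb x by (rule place_subring_valued_evaluation[OF V])
  have "w \<in> V" using integral_mem V x by (auto simp: place_subring_def)
  then show ?thesis by (induction G) (auto intro!: V_closed eval_mem[OF x])
qed

text \<open>
  Some element is not in \<open>V\<close>, so \<open>V\<close> has a nonzero nonunit; its norm is a polynomial in \<open>x\<close> that is
  a nonunit.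
\<close>

lemma near_point_exists:
  assumes V: "place_subring V" and x: "x \<in> V"
  shows "\<exists>a. x - emb a \<in> nonunits V"
proof -
  interpret valued_evaluation UNIV V emb x by (rule place_subring_valued_evaluation[OF V])
  obtain z where z: "z \<notin> V" using V by (auto simp: place_subring_def)
  then have inv: "inverse z \<in> nonunits V" "inverse z \<noteq> 0"
    using not_mem_imp_inverse_nonunit V_closed(2) by auto
  obtain G D where GD: "Polynomial.degree G < m" "D \<noteq> 0" "inverse z = W.eval G / X.eval D"
    by (rule element_as_quotient)
  then have "G \<noteq> 0" using inv by auto
  then obtain H N where N: "N \<noteq> 0" "W.eval G * W.eval H = X.eval N"
    using norm_exists GD(1) by blast
  have "W.eval G = inverse z * X.eval D" using GD X_eval_eq_0_iff by simp
  then have "X.eval N = inverse z * (X.eval D * W.eval H)" using N(2) by (simp add: mult.assoc)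
  also have "\<dots> \<in> nonunits V" by (intro nonunits_mult inv V_closed W_eval_mem[OF V x] eval_mem x)
  finally show ?thesis using eval_nonunit_imp_near_root[OF x _ N(1)] by blast
qed

definition at_point :: "'k \<Rightarrow> 'k \<Rightarrow> 'k poly poly \<Rightarrow> 'k" where
  "at_point a b G = poly (poly G [:b:]) a"

lemma at_point_simps [simp]:
  "at_point a b (G + H) = at_point a b G + at_point a b H"
  "at_point a b (G - H) = at_point a b G - at_point a b H"
  "at_point a b (G * H) = at_point a b G * at_point a b H"
  "at_point a b 0 = 0"
  "at_point a b 1 = 1"
  "at_point a b [:p:] = poly p a"
  "at_point a b (pCons p G) = poly p a + b * at_point a b G"
  by (simp_all add: at_point_def)

lemma at_point_as_poly: "at_point a b G = poly (map_poly (\<lambda>p. poly p a) G) b"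
  by (induction G) (simp_all add: map_poly_pCons at_point_def)

lemma at_point_expansion:
  "\<exists>A B. W.eval G - emb (at_point a b G) = (x - emb a) * X.eval A + (w - emb b) * W.eval B"
proof -
  have "poly (G - [:poly G [:b:]:]) [:b:] = 0" by simp
  then obtain B where B: "G - [:poly G [:b:]:] = [:- [:b:], 1:] * B"
    unfolding poly_eq_0_iff_dvd by blast
  have "poly (poly G [:b:] - [:at_point a b G:]) a = 0" by (simp add: at_point_def)
  then obtain A where A: "poly G [:b:] - [:at_point a b G:] = [:- a, 1:] * A"
    unfolding poly_eq_0_iff_dvd by blast
  have "W.eval G - X.eval (poly G [:b:]) = (w - emb b) * W.eval B"
    using arg_cong[OF B, of W.eval] unfolding W.eval_diff W.eval_mult
    by (simp add: X.eval_minus X.h_minus)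
  moreover have "X.eval (poly G [:b:]) - emb (at_point a b G) = (x - emb a) * X.eval A"
    using arg_cong[OF A, of X.eval] unfolding X.eval_diff X.eval_mult
    by (simp add: X.h_minus X.h_1)
  ultimately have "W.eval G - emb (at_point a b G) = (x - emb a) * X.eval A + (w - emb b) * W.eval B"
    by (simp add: algebra_simps)
  then show ?thesis by blast
qed

lemma congruent_at_point:
  assumes V: "place_subring V" and near: "x - emb a \<in> nonunits V" "w - emb b \<in> nonunits V"
  shows "W.eval G - emb (at_point a b G) \<in> nonunits V"
proof -
  interpret valued_evaluation UNIV V emb x by (rule place_subring_valued_evaluation[OF V])
  obtain A B where "W.eval G - emb (at_point a b G) = (x - emb a) * X.eval A + (w - emb b) * W.eval B"
    using at_point_expansion by blast
  then show ?thesis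
    by (auto intro!: nonunits_add nonunits_mult near W_eval_mem[OF V] near_mem[OF near(1)] eval_mem[OF near_mem[OF near(1)]])
qed

context
  fixes a b :: 'k
  assumes point: "b ^ m = poly f a" and smooth: "poly f a \<noteq> 0"
begin

text \<open>
  Evaluation at a point of the curve is well defined on \<open>K[x, w]\<close>.
\<close>

lemma W_eval_eq_0_imp_at_point: "W.eval G = 0 \<Longrightarrow> at_point a b G = 0"
proof -
  assume "W.eval G = 0"
  then obtain Q where "G = curve * Q" using W_eval_eq_0_imp_dvd by blast
  moreover have "at_point a b curve = 0"
    by (simp add: curve_def at_point_def poly_monom poly_power point)
  ultimately show ?thesis by simp
qed

text \<open>
  The factorization \<open>w\<^sup>m - b\<^sup>m = (w - b) U\<close> with \<open>U(b) = m b\<^sup>m\<^sup>-\<^sup>1 \<noteq> 0\<close> shows that \<open>w - b\<close> is locally a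
  multiple of \<open>x - a\<close>, so that \<open>x - a\<close> generates the maximal ideal at \<open>(a, b)\<close>.
\<close>

lemma tangent:
  obtains U q where "at_point a b U \<noteq> 0" "(w - emb b) * W.eval U = (x - emb a) * X.eval q"
proof -
  define p where "p = Polynomial.monom 1 m - [:poly f a:]"
  have "poly p b = 0" by (simp add: p_def poly_monom point)
  then obtain u where u: "p = [:- b, 1:] * u" unfolding poly_eq_0_iff_dvd by blast
  have sqf: "rsquarefree p" unfolding p_def by (rule rsquarefree_binomial[OF m_nonzero smooth])
  have ub: "poly u b \<noteq> 0"
  proof
    assume "poly u b = 0"
    then obtain v where "u = [:- b, 1:] * v" unfolding poly_eq_0_iff_dvd by blast
    then have "[:- b, 1:] ^ 2 dvd p"
      unfolding u by (metis dvd_triv_left mult.assoc power2_eq_square)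
    moreover have "p \<noteq> 0" using sqf by (simp add: rsquarefree_def)
    ultimately have "2 \<le> Polynomial.order b p" by (simp add: order_divides)
    then show False using sqf by (auto simp: rsquarefree_def dest: spec[of _ b])
  qed
  define U where "U = map_poly (\<lambda>c. [:c:]) u"
  interpret w: evaluation emb w by unfold_locales
  have U_eval: "W.eval U = w.eval u"
    unfolding U_def by (induction u) (simp_all add: map_poly_pCons)
  have U_at: "at_point a b U = poly u b"
    unfolding U_def by (induction u) (simp_all add: map_poly_pCons at_point_def)
  have "poly (f - [:poly f a:]) a = 0" by simp
  then obtain q where q: "f - [:poly f a:] = [:- a, 1:] * q" unfolding poly_eq_0_iff_dvd by blast
  have "(w - emb b) * w.eval u = w.eval p"
    unfolding u w.eval_mult by (simp add: X.h_minus X.h_1)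
  also have "\<dots> = X.eval (f - [:poly f a:])"
    by (simp add: p_def w.eval_diff w.eval_monom X.h_1 w_power X.eval_diff)
  also have "\<dots> = (x - emb a) * X.eval q"
    unfolding q X.eval_mult by (simp add: X.h_minus X.h_1)
  finally show ?thesis using that[of U q] U_at U_eval ub by simp
qed

text \<open>The local ring of \<open>(a, b)\<close> avoids \<open>1 / (x - a)\<close>, so a valuation ring contains it.\<close>

lemma smooth_place_exists:
  obtains V where "place_subring V" "x - emb a \<in> nonunits V" "w - emb b \<in> nonunits V"
proof -
  define A where "A = {W.eval G / W.eval H | G H. at_point a b H \<noteq> 0}"
  have A_intro: "W.eval G / W.eval H \<in> A" if "at_point a b H \<noteq> 0" for G H
    using that unfolding A_def by blast
  have den: "W.eval H \<noteq> 0" if "at_point a b H \<noteq> 0" for H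
    using that W_eval_eq_0_imp_at_point by blast
  have W_mem: "W.eval G \<in> A" for G
    using A_intro[of 1 G] by simp
  have "is_subring A"
    unfolding is_subring_def
  proof (intro conjI ballI)
    show "1 \<in> A" using W_mem[of 1] by simp
  next
    fix z z' assume "z \<in> A" "z' \<in> A"
    then obtain G H G' H' where *: "z = W.eval G / W.eval H" "z' = W.eval G' / W.eval H'"
      "at_point a b H \<noteq> 0" "at_point a b H' \<noteq> 0" by (auto simp: A_def)
    have "z - z' = W.eval (G * H' - G' * H) / W.eval (H * H')"
      using * den[of H] den[of H'] by (simp add: W.eval_diff W.eval_mult diff_frac_eq)
    moreover have "z * z' = W.eval (G * G') / W.eval (H * H')"
      using * by (simp add: W.eval_mult)
    moreover have "at_point a b (H * H') \<noteq> 0" using * by simp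
    ultimately show "z - z' \<in> A" "z * z' \<in> A" using A_intro[of "H * H'"] by presburger+
  qed
  moreover have "x - emb a \<in> A"
    using W_mem[of "[:[:- a, 1:]:]"] by (simp add: X.h_minus X.h_1)
  moreover have "inverse (x - emb a) \<notin> A"
  proof
    assume "inverse (x - emb a) \<in> A"
    then obtain G H where H: "inverse (x - emb a) = W.eval G / W.eval H" "at_point a b H \<noteq> 0"
      by (auto simp: A_def)
    then have "W.eval (H - [:[:- a, 1:]:] * G) = 0"
      using den[of H] x_minus_const_nz[of a]
      unfolding W.eval_diff W.eval_mult by (simp add: X.h_minus X.h_1 field_simps)
    then have "at_point a b (H - [:[:- a, 1:]:] * G) = 0" by (rule W_eval_eq_0_imp_at_point)
    then show False using H(2) by (simp del: mult_pCons_left)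
  qed
  ultimately obtain V where V: "valuation_subring UNIV V" "A \<subseteq> V" "x - emb a \<in> nonunits V"
    using valuation_subring_exists[of A "x - emb a"] x_minus_const_nz by blast
  interpret valuation_subring UNIV V by (rule V)
  have "emb c \<in> A" for c using W_mem[of "[:[:c:]:]"] by simp
  then have emb_V: "range emb \<subseteq> V" using V(2) by blast
  have "place_subring V"
    using nonunit_nz_imp_place_subring[OF V(1) emb_V V(3) x_minus_const_nz] .
  moreover obtain U q where U: "at_point a b U \<noteq> 0" "(w - emb b) * W.eval U = (x - emb a) * X.eval q"
    by (rule tangent)
  have "X.eval q / W.eval U \<in> V"
    using A_intro[OF U(1), of "[:q:]"] V(2) by auto
  then have "(x - emb a) * (X.eval q / W.eval U) \<in> nonunits V" by (rule nonunits_mult[OF V(3)])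
  moreover have "(x - emb a) * (X.eval q / W.eval U) = w - emb b"
    using U(2) den[OF U(1)] by (simp add: field_simps)
  ultimately show ?thesis using that V(3) by simp
qed

text \<open>
  The norm of \<open>G(x, w)\<close> has a value with respect to \<open>x - a\<close>. If \<open>G\<close> vanishes at \<open>(a, b)\<close>, then
  \<open>x - a\<close> can be split off from \<open>G(x, w)\<close>, up to the local unit \<open>U\<close>, and this lowers the value of
  the norm.
\<close>

lemma smooth_place_has_value:
  assumes V: "place_subring V" and near: "x - emb a \<in> nonunits V" "w - emb b \<in> nonunits V"
    and e: "is_unit_in V e" and GH: "W.eval G * W.eval H = (x - emb a) ^ n * e"
  shows "\<exists>k. has_value V (x - emb a) k (W.eval G)"
  using e GH
proof (induction n arbitrary: G H e)
  case (0 G H e)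
  interpret valued_evaluation UNIV V emb x by (rule place_subring_valued_evaluation[OF V])
  note mem = W_eval_mem[OF V near_mem[OF near(1)]]
  have "W.eval G \<notin> nonunits V"
    using nonunits_mult[OF _ mem, of "W.eval G" H] 0 unit_not_nonunit[OF 0(1)] by auto
  then show ?case using has_value_unit unit_or_nonunit[OF mem] by blast
next
  case (Suc n G H e)
  interpret valued_evaluation UNIV V emb x by (rule place_subring_valued_evaluation[OF V])
  have unit_iff: "is_unit_in V (W.eval P)" if "at_point a b P \<noteq> 0" for P
    using unit_plus_nonunit[OF const_unit[OF that] congruent_at_point[OF V near, of P]] by simp
  show ?case
  proof (cases "at_point a b G = 0")
    case False
    then show ?thesis using unit_iff has_value_unit by blast
  next
    case True
    obtain U q where U: "at_point a b U \<noteq> 0" "(w - emb b) * W.eval U = (x - emb a) * X.eval q"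
      by (rule tangent)
    obtain A B where AB: "W.eval G = (x - emb a) * X.eval A + (w - emb b) * W.eval B"
      using at_point_expansion[of G a b] True by (auto simp: X.h_0)
    define G' where "G' = U * [:A:] + [:q:] * B"
    have "W.eval U * W.eval G = (x - emb a) * (W.eval U * X.eval A) + ((w - emb b) * W.eval U) * W.eval B"
      unfolding AB by (simp add: algebra_simps)
    also have "\<dots> = (x - emb a) * W.eval G'"
      unfolding U(2) G'_def W.eval_add W.eval_mult by (simp add: algebra_simps)
    finally have G': "W.eval U * W.eval G = (x - emb a) * W.eval G'" .
    have "(x - emb a) * (W.eval G' * W.eval H) = W.eval U * (W.eval G * W.eval H)"
      by (simp only: mult.assoc [symmetric] G')
    also have "\<dots> = (x - emb a) * ((x - emb a) ^ n * (W.eval U * e))"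
      unfolding Suc.prems(2) by (simp only: power_Suc ac_simps)
    finally have "W.eval G' * W.eval H = (x - emb a) ^ n * (W.eval U * e)"
      using x_minus_const_nz[of a] by simp
    then obtain k where "has_value V (x - emb a) k (W.eval G')"
      using Suc.IH[OF unit_mult[OF unit_iff[OF U(1)] Suc.prems(1)]] by blast
    then have "has_value V (x - emb a) (1 + k - 0) ((x - emb a) * W.eval G' / W.eval U)"
      using unit_iff[OF U(1)] x_minus_const_nz
      by (intro has_value_divide has_value_mult has_value_self has_value_unit) auto
    moreover have "(x - emb a) * W.eval G' / W.eval U = W.eval G"
      using unit_iff[OF U(1)] by (simp flip: G' add: is_unit_in_def)
    ultimately show ?thesis by auto
  qed
qed

lemma smooth_place_discrete:
  assumes V: "place_subring V" and near: "x - emb a \<in> nonunits V" "w - emb b \<in> nonunits V"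
  shows "discrete_valuation_subring UNIV V (x - emb a)"
proof -
  interpret valued_evaluation UNIV V emb x by (rule place_subring_valued_evaluation[OF V])
  interpret uniformized UNIV V "x - emb a"
    by unfold_locales (use near x_minus_const_nz in auto)
  have poly_value: "\<exists>k. has_value V (x - emb a) k (X.eval D)" if D: "D \<noteq> 0" for D
  proof -
    obtain u where "is_unit_in V u" "X.eval D = (x - emb a) ^ Polynomial.order a D * u"
      using eval_order[OF near(1) D] by blast
    then show ?thesis
      unfolding has_value_def by (intro exI[of _ "int (Polynomial.order a D)"] exI[of _ u]) simp
  qed
  show ?thesis
  proof
    fix z assume "z \<noteq> (0 :: 'f)"
    obtain G D where GD: "Polynomial.degree G < m" "D \<noteq> 0" "z = W.eval G / X.eval D"
      by (rule element_as_quotient)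
    then have "G \<noteq> 0" using \<open>z \<noteq> 0\<close> by auto
    then obtain H N where N: "N \<noteq> 0" "W.eval G * W.eval H = X.eval N"
      using norm_exists GD(1) by blast
    then obtain u where "is_unit_in V u" "W.eval G * W.eval H = (x - emb a) ^ Polynomial.order a N * u"
      using eval_order[OF near(1) N(1)] by auto
    then have "\<exists>k. has_value V (x - emb a) k (W.eval G)"
      by (rule smooth_place_has_value[OF V near])
    then show "\<exists>n. has_value V (x - emb a) n z"
      using poly_value[OF GD(2)] has_value_divide[OF t_nz] GD(3) by blast
  qed
qed

end

text \<open>
  At a place over \<open>a\<close>, the residue of \<open>w\<close> is an \<open>m\<close>-th root of the residue \<open>f(a)\<close> of \<open>w\<^sup>m\<close>.
\<close>

lemma smooth_near_point:
  assumes V: "place_subring V" and near: "x - emb a \<in> nonunits V"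
  shows "\<exists>b. b ^ m = poly f a \<and> w - emb b \<in> nonunits V"
proof -
  interpret valued_evaluation UNIV V emb x by (rule place_subring_valued_evaluation[OF V])
  interpret w: valued_evaluation UNIV V emb w by (rule place_subring_valued_evaluation[OF V])
  have wV: "w \<in> V" using integral_mem V near_mem[OF near] by (auto simp: place_subring_def)
  define p where "p = Polynomial.monom 1 m - [:poly f a:]"
  have "w.eval p = X.eval f - emb (poly f a)"
    by (simp add: p_def w.eval_diff w.eval_monom X.h_1 w_power)
  then have "w.eval p \<in> nonunits V" using eval_congruent[OF near] by simp
  moreover have "p \<noteq> 0"
    using degree_binomial[of m "poly f a"] m_ge_2 by (auto simp: p_def)
  ultimately obtain b where "poly p b = 0" "w - emb b \<in> nonunits V"
    using w.eval_nonunit_imp_near_root[OF wV] by blast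
  then show ?thesis by (auto simp: p_def poly_monom)
qed

lemma place_exists_over_finite_point:
  obtains V where "place_subring V" "x - emb a \<in> nonunits V"
proof -
  have "is_subring (range X.eval)"
    unfolding is_subring_def
    by (auto simp flip: X.eval_diff X.eval_mult intro: range_eqI[of _ _ 1])
  moreover have "x - emb a \<in> range X.eval"
    by (rule range_eqI[of _ _ "[:- a, 1:]"]) (simp add: X.h_minus X.h_1)
  moreover have "inverse (x - emb a) \<notin> range X.eval"
  proof
    assume "inverse (x - emb a) \<in> range X.eval"
    then obtain p where "inverse (x - emb a) = X.eval p" by blast
    then have "(x - emb a) * X.eval p = 1" using x_minus_const_nz[of a] by (metis right_inverse)
    then have "X.eval ([:- a, 1:] * p - 1) = 0"
      unfolding X.eval_diff X.eval_mult by (simp add: X.h_minus X.h_1)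
    then have "[:- a, 1:] * p = 1" using X_eval_eq_0_iff by simp
    then have "poly ([:- a, 1:] * p) a = poly 1 a" by (rule arg_cong)
    then show False by simp
  qed
  ultimately obtain V where V: "valuation_subring UNIV V" "range X.eval \<subseteq> V" "x - emb a \<in> nonunits V"
    using valuation_subring_exists x_minus_const_nz by blast
  have "emb c \<in> range X.eval" for c by (rule range_eqI[of _ _ "[:c:]"]) simp
  then have "range emb \<subseteq> V" using V(2) by blast
  then show ?thesis
    using that V nonunit_nz_imp_place_subring x_minus_const_nz by blast
qed

text \<open>
  Every place lies over infinity, over a zero of \<open>f\<close>, or over a point where \<open>f\<close> does not vanish, and a
  uniformizer is known in each case.
\<close>

theorem place_subring_discrete:
  assumes V: "place_subring V"
  obtains t where "discrete_valuation_subring UNIV V t"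
proof (cases "x \<in> V")
  case False
  then obtain t where "monomial_place emb x w f m r V t (\<lambda>p. - int (Polynomial.degree p)) (- int r)"
    using infinite_monomial_place V by (auto simp: place_subring_def)
  then show ?thesis using monomial_place.discrete that by blast
next
  case True
  then obtain a where a: "x - emb a \<in> nonunits V" using near_point_exists[OF V] by blast
  show ?thesis
  proof (cases "poly f a = 0")
    case True
    have "valuation_subring UNIV V" "range emb \<subseteq> V" using V by (auto simp: place_subring_def)
    then have "monomial_place emb x w f m r V w (\<lambda>p. int (Polynomial.order a p)) 1"
      using a True by (rule root_monomial_place)
    then show ?thesis using monomial_place.discrete that by blast
  next
    case False
    obtain b where "b ^ m = poly f a" "w - emb b \<in> nonunits V"
      using smooth_near_point[OF V a] by blast
    then show ?thesis using smooth_place_discrete[OF _ False V a] that by blast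
  qed
qed

section \<open>Functions with poles in prescribed fibres\<close>

text \<open>
  Over a zero of \<open>f\<close> the values of the terms are distinct, so each term \<open>p\<^sub>j(x) w\<^sup>j / D(x)\<close> is itself
  regular, and \<open>w\<^sup>j\<close> with \<open>j < m\<close> cannot compensate for a zero of \<open>D\<close>. Over any other point, the polynomial
  with coefficients \<open>p\<^sub>j(a)\<close> has degree less than \<open>m\<close> and vanishes at the \<open>m\<close> roots \<open>b\<close> of \<open>b\<^sup>m = f(a)\<close>.
\<close>

lemma denominator_root_cancels:
  assumes G: "Polynomial.degree G < m" and D: "D \<noteq> 0" "poly D a = 0"
    and regular: "\<And>V. place_subring V \<Longrightarrow> x - emb a \<in> nonunits V \<Longrightarrow> W.eval G / X.eval D \<in> V"
  shows "poly (Polynomial.coeff G j) a = 0"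
proof (cases "poly f a = 0")
  case True
  obtain V where V: "place_subring V" "x - emb a \<in> nonunits V"
    by (rule place_exists_over_finite_point)
  interpret monomial_place emb x w f m r V w "\<lambda>p. int (Polynomial.order a p)" 1
    using root_monomial_place V True by (auto simp: place_subring_def)
  show ?thesis
  proof (cases "Polynomial.coeff G j = 0")
    case False
    then have "G \<noteq> 0" by auto
    then have "int m * int (Polynomial.order a (Polynomial.coeff G j)) + int j
        \<ge> int m * int (Polynomial.order a D)"
      using quotient_mem_iff[OF _ G D(1)] regular[OF V] False by auto
    moreover have "Polynomial.order a D \<ge> 1" using D order_root[of D a] by auto
    then have "int m * 1 \<le> int m * int (Polynomial.order a D)" by (intro mult_left_mono) auto
    moreover have "j < m" using False G le_degree[of G j] by simp
    ultimately have "Polynomial.order a (Polynomial.coeff G j) \<noteq> 0" by (intro notI) simp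
    then show ?thesis using order_root by blast
  qed simp
next
  case False
  define g where "g = map_poly (\<lambda>p. poly p a) G"
  have "g = 0"
  proof (rule poly_zero_if_many_roots)
    show "Polynomial.degree g < card {b. b ^ m = poly f a}"
      unfolding card_roots_binomial[OF m_nonzero False] g_def
      using map_poly_degree_leq[of _ G] G by (rule le_less_trans)
    fix b assume "b \<in> {b. b ^ m = poly f a}"
    then have b: "b ^ m = poly f a" by simp
    obtain V where V: "place_subring V" "x - emb a \<in> nonunits V" "w - emb b \<in> nonunits V"
      by (rule smooth_place_exists[OF b False])
    interpret valued_evaluation UNIV V emb x by (rule place_subring_valued_evaluation[OF V(1)])
    have "X.eval D * (W.eval G / X.eval D) \<in> nonunits V"
      using eval_nonunit_iff[OF V(2), of D] D(2) regular[OF V(1,2)] nonunits_mult by blast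
    then have "W.eval G \<in> nonunits V" using D(1) X_eval_eq_0_iff by simp
    then have "W.eval G - (W.eval G - emb (at_point a b G)) \<in> nonunits V"
      by (intro nonunits_diff congruent_at_point V)
    then have "at_point a b G = 0" by (simp add: const_nonunit_iff)
    then show "poly g b = 0" by (simp add: g_def at_point_as_poly)
  qed
  then have "Polynomial.coeff g j = 0" by simp
  then show ?thesis by (simp add: g_def coeff_map_poly)
qed

theorem regular_outside_imp_quotient:
  assumes regular: "\<And>V a. place_subring V \<Longrightarrow> x - emb a \<in> nonunits V \<Longrightarrow> a \<notin> S \<Longrightarrow> z \<in> V"
  shows "\<exists>G D. Polynomial.degree G < m \<and> D \<noteq> 0 \<and> z = W.eval G / X.eval D
    \<and> (\<forall>a. poly D a = 0 \<longrightarrow> a \<in> S)"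
proof -
  have "\<exists>G D. Polynomial.degree G < m \<and> D \<noteq> 0 \<and> z = W.eval G / X.eval D \<and> (\<forall>a. poly D a = 0 \<longrightarrow> a \<in> S)"
    if "Polynomial.degree G < m" "D \<noteq> 0" "z = W.eval G / X.eval D" for G D
    using that
  proof (induction "Polynomial.degree D" arbitrary: G D rule: less_induct)
    case less
    show ?case
    proof (cases "\<forall>a. poly D a = 0 \<longrightarrow> a \<in> S")
      case True
      then show ?thesis using less.prems by blast
    next
      case False
      then obtain a where a: "poly D a = 0" "a \<notin> S" by blast
      obtain D' where D': "D = [:- a, 1:] * D'" using a(1) by (auto simp: poly_eq_0_iff_dvd)
      then have D'0: "D' \<noteq> 0" using less.prems(2) by auto
      have "poly (Polynomial.coeff G j) a = 0" for j
        using denominator_root_cancels[OF less.prems(1,2) a(1)] regular[OF _ _ a(2)] less.prems(3)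
        by blast
      then have "[:[:- a, 1:]:] dvd G"
        by (simp add: const_poly_dvd_iff poly_eq_0_iff_dvd)
      then obtain G' where G': "G = [:[:- a, 1:]:] * G'" by blast
      have "Polynomial.degree G' = Polynomial.degree G"
        unfolding G' by (simp del: smult_pCons)
      moreover have "z = W.eval G' / X.eval D'"
        using less.prems(3) x_minus_const_nz[of a]
        unfolding G' D' W.eval_mult X.eval_mult by (simp add: X.h_minus X.h_1)
      moreover have "Polynomial.degree D' < Polynomial.degree D"
        unfolding D' using D'0 by (subst degree_mult_eq) auto
      ultimately show ?thesis using less.hyps[of D' G'] less.prems(1) D'0 by simp
    qed
  qed
  moreover obtain G D where "Polynomial.degree G < m" "D \<noteq> 0" "z = W.eval G / X.eval D"
    by (rule element_as_quotient)
  ultimately show ?thesis by blast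
qed

end

section \<open>Weierstrass semigroups of the curve\<close>

context superelliptic
begin

lemma closed_UNIV: "mult_inverse_closed (UNIV :: 'f set)"
  by (simp add: mult_inverse_closed_def)

lemma places_eq: "places (range emb) UNIV = nonunits ` {V. place_subring V}"
  unfolding places_eq_nonunits[OF closed_UNIV] place_subring_iff ..

lemma place_subring_eqI:
  "place_subring V \<Longrightarrow> place_subring V' \<Longrightarrow> nonunits V = nonunits V' \<Longrightarrow> V = V'"
  using nonunits_inj[OF closed_UNIV] place_subring_iff by blast

lemma place_val_eq:
  assumes "place_subring V" "discrete_valuation_subring UNIV V t" "has_value V t n z"
  shows "place_val (range emb) UNIV (nonunits V) z = n"
  using discrete_valuation_subring.place_val_nonunits[OF assms(2) closed_UNIV _ assms(3)]
    assms(1) place_subring_iff by blast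

lemma place_val_nonneg_iff:
  assumes V: "place_subring V" and z: "z \<noteq> 0"
  shows "place_val (range emb) UNIV (nonunits V) z \<ge> 0 \<longleftrightarrow> z \<in> V"
proof -
  obtain t where t: "discrete_valuation_subring UNIV V t" by (rule place_subring_discrete[OF V])
  interpret discrete_valuation_subring UNIV V t by (rule t)
  obtain n where n: "has_value V t n z" using has_value_ex z by blast
  show ?thesis unfolding place_val_eq[OF V t n] using has_value_mem_iff[OF n] by simp
qed

text \<open>
  The pole order at the place itself is \<open>max 0 (- k)\<close>, where \<open>k\<close> is the value; this includes the case
  \<open>n = 0\<close>, in which \<open>z\<close> has no poles at all.
\<close>

lemma weierstrass_semigroup_iff:
  assumes V: "place_subring V" and t: "discrete_valuation_subring UNIV V t"
  shows "n \<in> weierstrass_semigroup (range emb) UNIV (nonunits V) \<longleftrightarrow>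
    (\<exists>z k. has_value V t k z \<and> int n = max 0 (- k)
         \<and> (\<forall>V'. place_subring V' \<longrightarrow> V' \<noteq> V \<longrightarrow> z \<in> V'))"
proof -
  interpret discrete_valuation_subring UNIV V t by (rule t)
  have "pole_divisor (range emb) UNIV z = (\<lambda>Q. if Q = nonunits V then int n else 0) \<longleftrightarrow>
      int n = max 0 (- k) \<and> (\<forall>V'. place_subring V' \<longrightarrow> V' \<noteq> V \<longrightarrow> z \<in> V')"
    (is "?lhs \<longleftrightarrow> ?rhs") if k: "has_value V t k z" for z k
  proof -
    have z: "z \<noteq> 0" using has_value_nz[OF k] .
    have val: "place_val (range emb) UNIV (nonunits V) z = k" by (rule place_val_eq[OF V t k])
    have P: "nonunits V \<in> places (range emb) UNIV" using V places_eq by blast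
    show ?thesis
    proof
      assume ?lhs
      then have lhs: "pole_divisor (range emb) UNIV z Q = (if Q = nonunits V then int n else 0)" for Q
        by simp
      show ?rhs
      proof (intro conjI allI impI)
        show "int n = max 0 (- k)"
          using lhs[of "nonunits V"] P by (auto simp: pole_divisor_def val split: if_splits)
        fix V' assume V': "place_subring V'" "V' \<noteq> V"
        then have "nonunits V' \<noteq> nonunits V" "nonunits V' \<in> places (range emb) UNIV"
          using place_subring_eqI[OF V'(1) V] places_eq by auto
        then have "place_val (range emb) UNIV (nonunits V') z \<ge> 0"
          using lhs[of "nonunits V'"] by (auto simp: pole_divisor_def split: if_splits)
        then show "z \<in> V'" using place_val_nonneg_iff[OF V'(1) z] by simp
      qed
    next
      assume rhs: ?rhs
      show ?lhs
      proof
        fix Q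
        show "pole_divisor (range emb) UNIV z Q = (if Q = nonunits V then int n else 0)"
        proof (cases "Q = nonunits V")
          case True
          then show ?thesis using rhs P by (auto simp: pole_divisor_def val)
        next
          case False
          have "\<not> place_val (range emb) UNIV Q z < 0" if Q: "Q \<in> places (range emb) UNIV"
          proof -
            obtain V' where V': "place_subring V'" "Q = nonunits V'"
              using Q places_eq by auto
            then have "z \<in> V'" using rhs False by auto
            then show ?thesis using place_val_nonneg_iff[OF V'(1) z] V'(2) by simp
          qed
          then show ?thesis using False by (simp add: pole_divisor_def)
        qed
      qed
    qed
  qed
  note eq = this
  have "n \<in> weierstrass_semigroup (range emb) UNIV (nonunits V) \<longleftrightarrow>
      (\<exists>z. z \<noteq> 0 \<and> pole_divisor (range emb) UNIV z = (\<lambda>Q. if Q = nonunits V then int n else 0))"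
    by (simp add: weierstrass_semigroup_def)
  also have "\<dots> \<longleftrightarrow> (\<exists>z k. has_value V t k z
      \<and> pole_divisor (range emb) UNIV z = (\<lambda>Q. if Q = nonunits V then int n else 0))"
    using has_value_ex has_value_nz by (intro ex_cong1) (metis UNIV_I)
  finally show ?thesis using eq by (simp cong: conj_cong)
qed

end

lemma (in monomial_place) value_monomial_quotient:
  "D \<noteq> 0 \<Longrightarrow> p \<noteq> 0 \<Longrightarrow>
    has_value V t (int m * \<nu> p + s * int j - int m * \<nu> D) (X.eval p * w ^ j / X.eval D)"
  using has_value_divide[OF t_nz value_monomial value_poly] by blast

context superelliptic
begin

lemma monomial_place_unique:
  assumes "monomial_place emb x w f m r V t \<nu> s" "monomial_place emb x w f m r V' t' \<nu> s"
  shows "V = V'"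
proof -
  interpret V: monomial_place emb x w f m r V t \<nu> s by (rule assms)
  interpret V': monomial_place emb x w f m r V' t' \<nu> s by (rule assms)
  have "z \<in> V \<longleftrightarrow> z \<in> V'" for z
  proof (cases "z = 0")
    case True
    then show ?thesis using V.V_closed(2) V'.V_closed(2) by simp
  next
    case False
    obtain G D where GD: "Polynomial.degree G < m" "D \<noteq> 0" "z = W.eval G / X.eval D"
      by (rule element_as_quotient)
    then have "G \<noteq> 0" using False by auto
    then show ?thesis
      using V.quotient_mem_iff[OF _ GD(1,2)] V'.quotient_mem_iff[OF _ GD(1,2)] GD(3) by simp
  qed
  then show ?thesis by blast
qed

lemma place_subring_infinite:
  assumes "place_subring V" "x \<notin> V"
  obtains t where "monomial_place emb x w f m r V t (\<lambda>p. - int (Polynomial.degree p)) (- int r)"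
  using assms infinite_monomial_place unfolding place_subring_def by blast

lemma place_subring_root:
  assumes "place_subring V" "x - emb a \<in> nonunits V" "poly f a = 0"
  shows "monomial_place emb x w f m r V w (\<lambda>p. int (Polynomial.order a p)) 1"
  using assms root_monomial_place unfolding place_subring_def by blast

lemma infinite_unique:
  assumes "place_subring V" "x \<notin> V" "place_subring V'" "x \<notin> V'"
  shows "V = V'"
proof -
  obtain t where t: "monomial_place emb x w f m r V t (\<lambda>p. - int (Polynomial.degree p)) (- int r)"
    using place_subring_infinite[OF assms(1,2)] .
  obtain t' where "monomial_place emb x w f m r V' t' (\<lambda>p. - int (Polynomial.degree p)) (- int r)"
    using place_subring_infinite[OF assms(3,4)] .
  with t show ?thesis by (rule monomial_place_unique)
qed

lemma infinite_place_exists: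
  obtains V where "place_subring V" "x \<notin> V"
proof -
  obtain V where "valuation_subring UNIV V" "range emb \<subseteq> V" "x \<notin> V"
    by (rule infinite_valuation_subring_exists)
  then show ?thesis using that[of V] by (auto simp: place_subring_def)
qed

lemma near_imp_mem: "place_subring V \<Longrightarrow> x - emb a \<in> nonunits V \<Longrightarrow> x \<in> V"
  using valued_evaluation.near_mem[OF place_subring_valued_evaluation] .

lemma degree_eq_order:
  fixes D :: "'k poly"
  assumes D: "D \<noteq> 0" and roots: "\<And>b. poly D b = 0 \<Longrightarrow> b = a"
  shows "Polynomial.degree D = Polynomial.order a D"
proof -
  obtain q where q: "D = [:- a, 1:] ^ Polynomial.order a D * q" "\<not> [:- a, 1:] dvd q"
    using order_decomp[OF D] by blast
  have "poly q b \<noteq> 0" for b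
  proof
    assume b: "poly q b = 0"
    then have "poly D b = 0" by (subst q(1)) simp
    then show False using b q(2) roots by (auto simp: poly_eq_0_iff_dvd)
  qed
  then have "Polynomial.degree q = 0" using alg_closed_imp_poly_has_root[of q] by auto
  moreover have "q \<noteq> 0" using q(2) by auto
  ultimately show ?thesis
    by (subst q(1)) (simp add: degree_mult_eq degree_power_eq)
qed

text \<open>
  A function with poles only at infinity is a polynomial in \<open>x\<close> and \<open>w\<close>, and its pole order is that of
  its dominant monomial.
\<close>

theorem weierstrass_semigroup_infinite:
  assumes V: "place_subring V" and x: "x \<notin> V"
  shows "weierstrass_semigroup (range emb) UNIV (nonunits V) = {m * i + r * j | i j. True}"
proof -
  obtain t where t: "monomial_place emb x w f m r V t (\<lambda>p. - int (Polynomial.degree p)) (- int r)"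
    using place_subring_infinite[OF V x] .
  interpret monomial_place emb x w f m r V t "\<lambda>p. - int (Polynomial.degree p)" "- int r" by (rule t)
  note iff = weierstrass_semigroup_iff[OF V discrete]
  show ?thesis
  proof (intro equalityI subsetI)
    fix n assume "n \<in> weierstrass_semigroup (range emb) UNIV (nonunits V)"
    then obtain z k where z: "has_value V t k z" "int n = max 0 (- k)"
      and regular: "\<And>V'. place_subring V' \<Longrightarrow> V' \<noteq> V \<Longrightarrow> z \<in> V'"
      using iff by blast
    have finite_regular: "z \<in> V'" if "place_subring V'" "x - emb a \<in> nonunits V'" "a \<notin> {}" for V' a
      using regular[OF that(1)] near_imp_mem[OF that(1,2)] x by blast
    have "\<exists>G D. Polynomial.degree G < m \<and> D \<noteq> 0 \<and> z = W.eval G / X.eval D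
        \<and> (\<forall>a. poly D a = 0 \<longrightarrow> a \<in> {})"
      by (rule regular_outside_imp_quotient) (rule finite_regular)
    then obtain G D where "Polynomial.degree G < m \<and> D \<noteq> 0 \<and> z = W.eval G / X.eval D
        \<and> (\<forall>a. poly D a = 0 \<longrightarrow> a \<in> {})"
      by (elim exE) (rule that)
    then have GD: "Polynomial.degree G < m" "D \<noteq> 0" "z = W.eval G / X.eval D" "\<And>a. poly D a \<noteq> 0"
      by simp_all
    have "G \<noteq> 0" using has_value_nz[OF z(1)] GD(3) by auto
    then obtain j where "has_value V t (int m * - int (Polynomial.degree (Polynomial.coeff G j))
        + - int r * int j - int m * - int (Polynomial.degree D)) z"
      using value_quotient[OF _ GD(1,2)] GD(3) by blast
    moreover have "Polynomial.degree D = 0" using GD(4) alg_closed_imp_poly_has_root[of D] by auto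
    ultimately have "k = - int (m * Polynomial.degree (Polynomial.coeff G j) + r * j)"
      using has_value_unique[OF z(1)] by fastforce
    then have "int n = int (m * Polynomial.degree (Polynomial.coeff G j) + r * j)"
      using z(2) by (simp only: minus_minus max_absorb2 of_nat_0_le_iff)
    then have "n = m * Polynomial.degree (Polynomial.coeff G j) + r * j" by (simp only: of_nat_eq_iff)
    then show "n \<in> {m * i + r * j | i j. True}" by blast
  next
    fix n assume "n \<in> {m * i + r * j | i j. True}"
    then obtain i j where n: "n = m * i + r * j" by blast
    have "has_value V t (int m * - int (Polynomial.degree (Polynomial.monom (1 :: 'k) i)) + - int r * int j)
        (X.eval (Polynomial.monom 1 i) * w ^ j)"
      by (rule value_monomial) simp
    then have "has_value V t (- int n) (x ^ i * w ^ j)"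
      by (simp add: degree_monom_eq X.eval_monom X.h_1 n)
    moreover have "x ^ i * w ^ j \<in> V'" if V': "place_subring V'" "V' \<noteq> V" for V'
    proof -
      interpret V': valued_evaluation UNIV V' emb x by (rule place_subring_valued_evaluation[OF V'(1)])
      have "x \<in> V'" using infinite_unique[OF V'(1) _ V x] V'(2) by blast
      moreover from this have "w \<in> V'" using integral_mem V'(1) by (simp add: place_subring_def)
      ultimately show ?thesis by (auto intro!: V'.V_closed)
    qed
    ultimately show "n \<in> weierstrass_semigroup (range emb) UNIV (nonunits V)"
      unfolding iff by (intro exI[of _ "x ^ i * w ^ j"] exI[of _ "- int n"]) auto
  qed
qed

text \<open>
  At a zero \<open>a\<close> of \<open>f\<close> the monomial \<open>w\<^sup>j / (x - a)\<^sup>k\<close> has a pole of order \<open>m k - j\<close>, and it is regular at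
  infinity precisely if \<open>r j \<le> m k\<close>.
\<close>

theorem weierstrass_semigroup_root:
  assumes V: "place_subring V" and near: "x - emb a \<in> nonunits V" and root: "poly f a = 0"
  shows "weierstrass_semigroup (range emb) UNIV (nonunits V) =
    {n. \<exists>j k. j < m \<and> n + j = m * k \<and> r * j \<le> m * k}"
proof -
  interpret monomial_place emb x w f m r V w "\<lambda>p. int (Polynomial.order a p)" 1
    by (rule place_subring_root[OF V near root])
  interpret valued_evaluation UNIV V emb x by (rule place_subring_valued_evaluation[OF V])
  note iff = weierstrass_semigroup_iff[OF V discrete]
  show ?thesis
  proof (intro equalityI subsetI)
    fix n assume "n \<in> weierstrass_semigroup (range emb) UNIV (nonunits V)"
    then obtain z k where z: "has_value V w k z" "int n = max 0 (- k)"
      and regular: "\<And>V'. place_subring V' \<Longrightarrow> V' \<noteq> V \<Longrightarrow> z \<in> V'"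
      using iff by blast
    have other_regular: "z \<in> V'" if "place_subring V'" "x - emb b \<in> nonunits V'" "b \<notin> {a}" for V' b
      using regular[OF that(1)] near_unique[OF near, of b] that by blast
    have "\<exists>G D. Polynomial.degree G < m \<and> D \<noteq> 0 \<and> z = W.eval G / X.eval D
        \<and> (\<forall>b. poly D b = 0 \<longrightarrow> b \<in> {a})"
      by (rule regular_outside_imp_quotient) (rule other_regular)
    then obtain G D where "Polynomial.degree G < m \<and> D \<noteq> 0 \<and> z = W.eval G / X.eval D
        \<and> (\<forall>b. poly D b = 0 \<longrightarrow> b \<in> {a})"
      by (elim exE) (rule that)
    then have GD: "Polynomial.degree G < m" "D \<noteq> 0" "z = W.eval G / X.eval D"
      "\<And>b. poly D b = 0 \<Longrightarrow> b \<in> {a}"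
      by simp_all
    have G: "G \<noteq> 0" using has_value_nz[OF z(1)] GD(3) by auto
    define e where "e = Polynomial.order a D"
    have e: "Polynomial.degree D = e" using degree_eq_order[OF GD(2)] GD(4) by (auto simp: e_def)
    obtain j where j: "Polynomial.coeff G j \<noteq> 0"
      "has_value V w (int m * int (Polynomial.order a (Polynomial.coeff G j)) + 1 * int j - int m * int e) z"
      using value_quotient[OF G GD(1,2)] GD(3) by (auto simp: e_def)
    have k: "k = int m * int (Polynomial.order a (Polynomial.coeff G j)) + int j - int m * int e"
      using has_value_unique[OF z(1) j(2)] by simp
    obtain V' where V': "place_subring V'" "x \<notin> V'" by (rule infinite_place_exists)
    obtain t where "monomial_place emb x w f m r V' t (\<lambda>p. - int (Polynomial.degree p)) (- int r)"
      using place_subring_infinite[OF V'] .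
    then interpret V': monomial_place emb x w f m r V' t "\<lambda>p. - int (Polynomial.degree p)" "- int r" .
    have "z \<in> V'" using regular[OF V'(1)] V'(2) near_mem[OF near] by blast
    then have "int m * - int (Polynomial.degree (Polynomial.coeff G j)) + - int r * int j - int m * - int e \<ge> 0"
      using V'.quotient_mem_iff[OF G GD(1,2)] GD(3) j(1) e by auto
    moreover have "Polynomial.order a (Polynomial.coeff G j) \<le> Polynomial.degree (Polynomial.coeff G j)"
      using order_degree[OF j(1)] .
    then have "int m * int (Polynomial.order a (Polynomial.coeff G j))
        \<le> int m * int (Polynomial.degree (Polynomial.coeff G j))"
      by (intro mult_left_mono) auto
    ultimately have ineq: "int r * int j \<le> int m * int e - int m * int (Polynomial.order a (Polynomial.coeff G j))"
      by simp
    show "n \<in> {n. \<exists>j k. j < m \<and> n + j = m * k \<and> r * j \<le> m * k}"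
    proof (cases "n = 0")
      case True
      then show ?thesis using m_ge_2 by (intro CollectI exI[of _ 0]) auto
    next
      case False
      have "0 \<le> int m * (int e - int (Polynomial.order a (Polynomial.coeff G j)))"
        using order.trans[OF _ ineq, of 0] by (simp add: right_diff_distrib)
      then have le: "Polynomial.order a (Polynomial.coeff G j) \<le> e"
        using m_ge_2 by (simp add: zero_le_mult_iff)
      have "int n = int m * (int e - int (Polynomial.order a (Polynomial.coeff G j))) - int j"
        using z(2) k False by (simp add: right_diff_distrib max_def split: if_splits)
      then have "int (n + j) = int (m * (e - Polynomial.order a (Polynomial.coeff G j)))"
        using le by (simp add: of_nat_diff)
      then have 1: "n + j = m * (e - Polynomial.order a (Polynomial.coeff G j))"
        by (simp only: of_nat_eq_iff)
      have "int (r * j) \<le> int (m * (e - Polynomial.order a (Polynomial.coeff G j)))"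
        using ineq le by (simp add: of_nat_diff right_diff_distrib)
      then have 2: "r * j \<le> m * (e - Polynomial.order a (Polynomial.coeff G j))"
        by (simp only: of_nat_le_iff)
      have "j < m" using le_degree[OF j(1)] GD(1) by simp
      then show ?thesis using 1 2 by blast
    qed
  next
    fix n assume "n \<in> {n. \<exists>j k. j < m \<and> n + j = m * k \<and> r * j \<le> m * k}"
    then obtain j k where jk: "n + j = m * k" "r * j \<le> m * k" by blast
    define D where "D = [:- a, 1:] ^ k"
    have D: "D \<noteq> 0" by (simp add: D_def)
    define z where "z = w ^ j / X.eval D"
    have "has_value V w (int m * int (Polynomial.order a (1 :: 'k poly)) + 1 * int j
        - int m * int (Polynomial.order a D)) (X.eval 1 * w ^ j / X.eval D)"
      by (rule value_monomial_quotient[OF D]) simp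
    then have "has_value V w (int j - int (m * k)) z"
      by (simp add: z_def D_def order_power_n_n)
    then have "has_value V w (- int n) z" by (simp flip: jk(1))
    moreover have "z \<in> V'" if V': "place_subring V'" "V' \<noteq> V" for V'
    proof (cases "x \<in> V'")
      case False
      obtain t where "monomial_place emb x w f m r V' t (\<lambda>p. - int (Polynomial.degree p)) (- int r)"
        using place_subring_infinite[OF V'(1) False] .
      then interpret V': monomial_place emb x w f m r V' t "\<lambda>p. - int (Polynomial.degree p)" "- int r" .
      have "has_value V' t (int m * - int (Polynomial.degree (1 :: 'k poly)) + - int r * int j
          - int m * - int (Polynomial.degree D)) (X.eval 1 * w ^ j / X.eval D)"
        by (rule V'.value_monomial_quotient[OF D]) simp
      then have "has_value V' t (int (m * k) - int (r * j)) z"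
        by (simp add: z_def D_def degree_power_eq)
      then show ?thesis using V'.has_value_mem_iff jk(2) by (metis diff_ge_0_iff_ge of_nat_le_iff)
    next
      case True
      interpret V': valued_evaluation UNIV V' emb x by (rule place_subring_valued_evaluation[OF V'(1)])
      obtain b where b: "x - emb b \<in> nonunits V'" using near_point_exists[OF V'(1) True] by blast
      have "b \<noteq> a"
        using monomial_place_unique[OF place_subring_root[OF V'(1) _ root] place_subring_root[OF V near root]]
          b V'(2) by blast
      then have "is_unit_in V' (X.eval D)"
        by (intro V'.eval_unit[OF b]) (simp add: D_def)
      moreover have "w \<in> V'" using integral_mem V'(1) True by (simp add: place_subring_def)
      ultimately show ?thesis
        by (auto simp: z_def divide_inverse is_unit_in_def intro!: V'.V_closed)
    qed
    ultimately show "n \<in> weierstrass_semigroup (range emb) UNIV (nonunits V)"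
      unfolding iff by (intro exI[of _ z] exI[of _ "- int n"]) auto
  qed
qed

end

section \<open>Places of the rational function field\<close>

context valued_evaluation
begin

lemma eval_quotient_value:
  assumes near: "c - h a \<in> nonunits V" and AB: "A \<noteq> 0" "B \<noteq> 0" and nz: "c - h a \<noteq> 0"
  shows "has_value V (c - h a) (int (Polynomial.order a A) - int (Polynomial.order a B)) (eval A / eval B)"
proof -
  have "has_value V (c - h a) (int (Polynomial.order a p)) (eval p)" if "p \<noteq> 0" for p
    using eval_order[OF near that] by (auto simp: has_value_def)
  then show ?thesis using AB by (intro has_value_divide nz) auto
qed

lemma eval_quotient_value_infinite:
  assumes c: "c \<in> L" "c \<notin> V" and AB: "A \<noteq> 0" "B \<noteq> 0"
  shows "has_value V (inverse c) (int (Polynomial.degree B) - int (Polynomial.degree A)) (eval A / eval B)"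
proof -
  have c0: "inverse c \<noteq> 0" using c V_closed(2) by auto
  have "has_value V (inverse c) (- int (Polynomial.degree p)) (eval p)" if p: "p \<noteq> 0" for p
    using eval_infinite[OF c p] by (auto simp: has_value_def power_int_minus power_int_inverse power_inverse)
  then have "has_value V (inverse c) (- int (Polynomial.degree A) - - int (Polynomial.degree B)) (eval A / eval B)"
    using AB by (intro has_value_divide c0) auto
  then show ?thesis by simp
qed

end

context superelliptic
begin

definition rational_functions :: "'f set" where
  "rational_functions = field_gen (range emb) {x}"

lemma rational_functions_closed:
  "a \<in> rational_functions \<Longrightarrow> b \<in> rational_functions \<Longrightarrow> a * b \<in> rational_functions"
  "a \<in> rational_functions \<Longrightarrow> inverse a \<in> rational_functions"
  "x \<in> rational_functions" "emb c \<in> rational_functions"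
proof -
  show mult: "a \<in> rational_functions \<Longrightarrow> b \<in> rational_functions \<Longrightarrow> a * b \<in> rational_functions" for a b
    unfolding rational_functions_def field_gen_def
    using generate_field.eng_mult[of a ring_of_type_algebra _ b] by simp
  show "x \<in> rational_functions" "emb c \<in> rational_functions" for c
    unfolding rational_functions_def field_gen_def by (auto intro: generate_field.incl)
  then have "0 \<in> rational_functions" using X.h_0 by metis
  then show "a \<in> rational_functions \<Longrightarrow> inverse a \<in> rational_functions" for a
    unfolding rational_functions_def field_gen_def
    using generate_field.m_inv[of a ring_of_type_algebra] m_inv_ring_of_type_algebra[of a]
    by (cases "a = 0") auto
qed

lemma closed_rational_functions: "mult_inverse_closed rational_functions"
  using rational_functions_closed by (simp add: mult_inverse_closed_def)

lemma rational_functions_quotient: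
  assumes "z \<in> rational_functions"
  obtains A B where "B \<noteq> 0" "z = X.eval A / X.eval B"
proof -
  define S where "S = {X.eval A / X.eval B | A B. B \<noteq> 0}"
  have S_intro: "X.eval A / X.eval B \<in> S" if "B \<noteq> 0" for A B
    using that unfolding S_def by blast
  have "z \<in> S"
    using assms unfolding rational_functions_def field_gen_def
  proof (induction rule: generate_field.induct)
    case one
    show ?case using S_intro[of 1 1] by simp
  next
    case (incl z)
    then consider a where "z = emb a" | "z = x" by auto
    then show ?case
    proof cases
      case 1
      then show ?thesis using S_intro[of 1 "[:a:]"] by simp
    next
      case 2
      then show ?thesis using S_intro[of 1 "[:0, 1:]"] by (simp add: X.h_0 X.h_1)
    qed
  next
    case (a_inv z)
    then obtain A B where "B \<noteq> 0" "z = X.eval A / X.eval B" by (auto simp: S_def)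
    then show ?case using S_intro[of B "- A"] by (simp add: X.eval_minus)
  next
    case (m_inv z)
    then obtain A B where AB: "B \<noteq> 0" "z = X.eval A / X.eval B" by (auto simp: S_def)
    then have "A \<noteq> 0" using m_inv by auto
    then show ?case using S_intro[of A B] AB m_inv by (simp add: m_inv_ring_of_type_algebra)
  next
    case (eng_add z z')
    then obtain A B A' B' where *: "B \<noteq> 0" "z = X.eval A / X.eval B"
      "B' \<noteq> 0" "z' = X.eval A' / X.eval B'" by (auto simp: S_def)
    then have "z + z' = X.eval (A * B' + A' * B) / X.eval (B * B')"
      using X_eval_eq_0_iff by (simp add: X.eval_add X.eval_mult add_frac_eq)
    then show ?case using S_intro[of "B * B'"] * by simp
  next
    case (eng_mult z z')
    then obtain A B A' B' where *: "B \<noteq> 0" "z = X.eval A / X.eval B"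
      "B' \<noteq> 0" "z' = X.eval A' / X.eval B'" by (auto simp: S_def)
    then have "z * z' = X.eval (A * A') / X.eval (B * B')"
      by (simp add: X.eval_mult)
    then show ?case using S_intro[of "B * B'"] * by simp
  qed
  then show ?thesis using that by (auto simp: S_def)
qed

lemma rational_place_valued_evaluation:
  assumes "valuation_ring (range emb) rational_functions Q"
  shows "valued_evaluation rational_functions Q emb"
  using valuation_ring_imp_valuation_subring[OF closed_rational_functions assms] assms
  unfolding valued_evaluation_def valued_evaluation_axioms_def valuation_ring_def
  by (auto simp: evaluation_def emb_1 emb_add emb_mult)

lemma rational_place_near:
  assumes Q: "valuation_ring (range emb) rational_functions Q" and x: "x \<in> Q"
  shows "\<exists>a. x - emb a \<in> nonunits Q"
proof -
  interpret valued_evaluation rational_functions Q emb x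
    by (rule rational_place_valued_evaluation[OF Q])
  obtain z where z: "z \<in> rational_functions" "z \<notin> Q" using Q by (auto simp: valuation_ring_def)
  have inv: "inverse z \<in> nonunits Q" by (rule not_mem_imp_inverse_nonunit[OF z])
  obtain A B where AB: "B \<noteq> 0" "inverse z = X.eval A / X.eval B"
    using rational_functions_quotient rational_functions_closed(2)[OF z(1)] by blast
  then have "A \<noteq> 0" using z(2) V_closed(2) by auto
  have "X.eval A = inverse z * X.eval B" using AB X_eval_eq_0_iff by simp
  then have "X.eval A \<in> nonunits Q" using nonunits_mult[OF inv eval_mem[OF x]] by simp
  then show ?thesis using eval_nonunit_imp_near_root[OF x _ \<open>A \<noteq> 0\<close>] by blast
qed

lemma rational_place_infinite_discrete:
  assumes Q: "valuation_ring (range emb) rational_functions Q" and x: "x \<notin> Q"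
  shows "discrete_valuation_subring rational_functions Q (inverse x)"
proof -
  interpret valued_evaluation rational_functions Q emb x
    by (rule rational_place_valued_evaluation[OF Q])
  show ?thesis
  proof
    show "inverse x \<in> nonunits Q"
      by (rule not_mem_imp_inverse_nonunit[OF rational_functions_closed(3) x])
    show "inverse x \<noteq> 0" using x_nz by simp
    fix z assume z: "z \<in> rational_functions" "z \<noteq> 0"
    obtain A B where AB: "B \<noteq> 0" "z = X.eval A / X.eval B"
      using rational_functions_quotient[OF z(1)] .
    then have "A \<noteq> 0" using z(2) by auto
    then show "\<exists>n. has_value Q (inverse x) n z"
      using eval_quotient_value_infinite[OF rational_functions_closed(3) x _ AB(1)] AB(2) by blast
  qed
qed

lemma rational_place_finite_discrete:
  assumes Q: "valuation_ring (range emb) rational_functions Q" and near: "x - emb a \<in> nonunits Q"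
  shows "discrete_valuation_subring rational_functions Q (x - emb a)"
proof -
  interpret valued_evaluation rational_functions Q emb x
    by (rule rational_place_valued_evaluation[OF Q])
  show ?thesis
  proof
    show "x - emb a \<in> nonunits Q" "x - emb a \<noteq> 0" by (fact near x_minus_const_nz)+
    fix z assume z: "z \<in> rational_functions" "z \<noteq> 0"
    obtain A B where AB: "B \<noteq> 0" "z = X.eval A / X.eval B"
      using rational_functions_quotient[OF z(1)] .
    then have "A \<noteq> 0" using z(2) by auto
    then show "\<exists>n. has_value Q (x - emb a) n z"
      using eval_quotient_value[OF near _ AB(1) x_minus_const_nz] AB(2) by blast
  qed
qed

lemma rational_place_val_neg_iff:
  assumes Q: "valuation_ring (range emb) rational_functions Q"
  shows "place_val (range emb) rational_functions (nonunits Q) x < 0 \<longleftrightarrow> x \<notin> Q"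
proof -
  have "\<exists>t. discrete_valuation_subring rational_functions Q t"
    using rational_place_infinite_discrete[OF Q] rational_place_finite_discrete[OF Q]
      rational_place_near[OF Q] by blast
  then obtain t where t: "discrete_valuation_subring rational_functions Q t" by blast
  interpret discrete_valuation_subring rational_functions Q t by (rule t)
  obtain n where n: "has_value Q t n x"
    using has_value_ex[OF rational_functions_closed(3) x_nz] by blast
  show ?thesis
    unfolding place_val_nonunits[OF closed_rational_functions Q n] using has_value_mem_iff[OF n] by auto
qed

text \<open>
  The value of \<open>A(x) / B(x)\<close> is \<open>deg B - deg A\<close> in any valuation ring that does not contain \<open>x\<close>.
\<close>

lemma rational_place_infinite_unique:
  assumes Q: "valuation_ring (range emb) rational_functions Q" "x \<notin> Q"
    and Q': "valuation_ring (range emb) rational_functions Q'" "x \<notin> Q'"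
  shows "Q = Q'"
proof -
  interpret Q: valued_evaluation rational_functions Q emb x
    by (rule rational_place_valued_evaluation[OF Q(1)])
  interpret Q': valued_evaluation rational_functions Q' emb x
    by (rule rational_place_valued_evaluation[OF Q'(1)])
  interpret Qd: discrete_valuation_subring rational_functions Q "inverse x"
    by (rule rational_place_infinite_discrete[OF Q])
  interpret Qd': discrete_valuation_subring rational_functions Q' "inverse x"
    by (rule rational_place_infinite_discrete[OF Q'])
  have "z \<in> Q \<longleftrightarrow> z \<in> Q'" if z: "z \<in> rational_functions" for z
  proof (cases "z = 0")
    case True
    then show ?thesis using Q.V_closed(2) Q'.V_closed(2) by simp
  next
    case False
    obtain A B where AB: "B \<noteq> 0" "z = X.eval A / X.eval B"
      using rational_functions_quotient[OF z] .
    then have "A \<noteq> 0" using False by auto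
    note Q.eval_quotient_value_infinite[OF rational_functions_closed(3) Q(2) this AB(1)]
      Q'.eval_quotient_value_infinite[OF rational_functions_closed(3) Q'(2) this AB(1)]
    then show ?thesis using Qd.has_value_mem_iff Qd'.has_value_mem_iff AB(2) by blast
  qed
  then show ?thesis using Q.subset Q'.subset by blast
qed

text \<open>
  The pole of \<open>x\<close> in \<open>K(x)\<close> is obtained as the restriction of a place of \<open>F\<close>.
\<close>

lemma restrict_infinite_place:
  assumes V: "place_subring V" and x: "x \<notin> V"
  shows "valuation_ring (range emb) rational_functions (V \<inter> rational_functions)"
proof -
  interpret valued_evaluation UNIV V emb x by (rule place_subring_valued_evaluation[OF V])
  interpret R: field "ring_of_type_algebra :: 'f ring" ..
  have "subfield rational_functions (ring_of_type_algebra :: 'f ring)"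
    unfolding rational_functions_def field_gen_def by (rule R.generate_field_is_subfield) simp
  then have "is_subring rational_functions"
    using subfieldE(1) subring_iff_is_subring by blast
  then have "is_subring (V \<inter> rational_functions)"
    using subring unfolding is_subring_def by blast
  moreover have "range emb \<subseteq> V \<inter> rational_functions"
    using constants rational_functions_closed(4) by auto
  moreover have "inverse x \<in> V \<inter> rational_functions"
    using not_mem_imp_inverse_nonunit[of x] x rational_functions_closed(2,3) by (simp add: nonunits_iff)
  moreover have "inverse x \<notin> range emb"
  proof
    assume "inverse x \<in> range emb"
    then obtain c where c: "inverse x = emb c" by blast
    then have "x * emb c = 1" using x_nz by (metis right_inverse)
    then have "X.eval (pCons 0 [:c:] - 1) = 0" by (simp add: X.eval_diff X.h_0)
    then have "pCons 0 [:c:] = 1" using X_eval_eq_0_iff by simp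
    then show False by (simp add: one_pCons)
  qed
  moreover have "z \<in> V \<inter> rational_functions \<or> inverse z \<in> V \<inter> rational_functions"
    if "z \<in> rational_functions" for z
    using valuation[of z] that rational_functions_closed(2) by auto
  ultimately show ?thesis
    unfolding valuation_ring_def subring_iff_is_subring
    using x rational_functions_closed(3) by blast
qed

lemma Q_infty_eq:
  assumes V: "place_subring V" and x: "x \<notin> V"
  shows "Q_infty (range emb) x = nonunits (V \<inter> rational_functions)"
  unfolding Q_infty_def rational_functions_def [symmetric]
proof (rule the_equality)
  note Q = restrict_infinite_place[OF V x]
  show "nonunits (V \<inter> rational_functions) \<in> places (range emb) rational_functions
      \<and> place_val (range emb) rational_functions (nonunits (V \<inter> rational_functions)) x < 0"
    using Q rational_place_val_neg_iff[OF Q] x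
    by (auto simp: places_eq_nonunits[OF closed_rational_functions])
  fix P assume "P \<in> places (range emb) rational_functions \<and> place_val (range emb) rational_functions P x < 0"
  then obtain Q' where Q': "valuation_ring (range emb) rational_functions Q'" "P = nonunits Q'" "x \<notin> Q'"
    using rational_place_val_neg_iff by (auto simp: places_eq_nonunits[OF closed_rational_functions])
  then show "P = nonunits (V \<inter> rational_functions)"
    using rational_place_infinite_unique[OF Q'(1,3) Q] x by blast
qed

lemma P_infty_eq:
  assumes V: "place_subring V" and x: "x \<notin> V"
  shows "P_infty (range emb) x = nonunits V"
  unfolding P_infty_def Q_infty_eq[OF assms] places_over_def
proof (rule the_equality)
  interpret V: valued_evaluation UNIV V emb x by (rule place_subring_valued_evaluation[OF V])
  interpret Q: valued_evaluation rational_functions "V \<inter> rational_functions" emb x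
    by (rule rational_place_valued_evaluation[OF restrict_infinite_place[OF assms]])
  have "nonunits (V \<inter> rational_functions) \<subseteq> nonunits V"
    using rational_functions_closed(2) by (auto simp: Q.nonunits_iff V.nonunits_iff)
  then show "nonunits V \<in> {P \<in> places (range emb) UNIV. nonunits (V \<inter> rational_functions) \<subseteq> P}"
    using V places_eq by blast
  fix P assume "P \<in> {P \<in> places (range emb) UNIV. nonunits (V \<inter> rational_functions) \<subseteq> P}"
  then obtain V' where V': "place_subring V'" "P = nonunits V'" "nonunits (V \<inter> rational_functions) \<subseteq> P"
    using places_eq by auto
  interpret V': valued_evaluation UNIV V' emb x by (rule place_subring_valued_evaluation[OF V'(1)])
  have "inverse x \<in> nonunits (V \<inter> rational_functions)"
    using x by (intro Q.not_mem_imp_inverse_nonunit rational_functions_closed(3)) auto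
  then have "inverse x \<in> nonunits V'" using V'(2,3) by blast
  then have "x \<notin> V'" using x_nz by (simp add: V'.nonunits_iff)
  then show "P = nonunits V" using infinite_unique[OF V'(1) _ V x] V'(2) by blast
qed

text \<open>
  Over a point \<open>a\<close> with \<open>f(a) \<noteq> 0\<close> there are \<open>m \<ge> 2\<close> places, one for each \<open>m\<close>-th root of \<open>f(a)\<close>. They
  all lie over the same place of \<open>K(x)\<close>, since values of rational functions with respect to \<open>x - a\<close>
  are orders of vanishing at \<open>a\<close>.
\<close>

lemma unique_over_imp_root:
  assumes V: "place_subring V" and near: "x - emb a \<in> nonunits V"
    and Q: "Q \<in> places (range emb) rational_functions"
    and over: "places_over (range emb) UNIV Q = {nonunits V}"
  shows "poly f a = 0"
proof (rule ccontr)
  assume smooth: "poly f a \<noteq> 0"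
  interpret V: valued_evaluation UNIV V emb x by (rule place_subring_valued_evaluation[OF V])
  interpret w: valued_evaluation UNIV V emb w by (rule place_subring_valued_evaluation[OF V])
  obtain b where b: "b ^ m = poly f a" "w - emb b \<in> nonunits V"
    using smooth_near_point[OF V near] by blast
  have "card {c. c ^ m = poly f a} = m" by (rule card_roots_binomial[OF m_nonzero smooth])
  then have "\<not> {c. c ^ m = poly f a} \<subseteq> {b}"
    using m_ge_2 card_mono[of "{b}" "{c. c ^ m = poly f a}"] by auto
  then obtain c where c: "c ^ m = poly f a" "c \<noteq> b" by blast
  obtain V' where V': "place_subring V'" "x - emb a \<in> nonunits V'" "w - emb c \<in> nonunits V'"
    by (rule smooth_place_exists[OF c(1) smooth])
  have "V' \<noteq> V" using w.near_unique[OF b(2)] c(2) V'(3) by blast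
  obtain R where R: "valuation_ring (range emb) rational_functions R" "Q = nonunits R"
    using Q by (auto simp: places_eq_nonunits[OF closed_rational_functions])
  interpret R: valued_evaluation rational_functions R emb x
    by (rule rational_place_valued_evaluation[OF R(1)])
  have QV: "Q \<subseteq> nonunits V" using over by (auto simp: places_over_def)
  have "x \<in> R"
  proof (rule ccontr)
    assume "x \<notin> R"
    then have "inverse x \<in> nonunits V"
      using R.not_mem_imp_inverse_nonunit[OF rational_functions_closed(3)] R(2) QV by blast
    then show False using V.near_mem[OF near] x_nz by (simp add: V.nonunits_iff)
  qed
  then obtain d where "x - emb d \<in> nonunits R" using rational_place_near[OF R(1)] by blast
  moreover from this have "d = a" using R(2) QV V.near_unique[OF near] by blast
  ultimately have near_R: "x - emb a \<in> nonunits R" by simp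
  interpret Rd: discrete_valuation_subring rational_functions R "x - emb a"
    by (rule rational_place_finite_discrete[OF R(1) near_R])
  interpret V': valued_evaluation UNIV V' emb x by (rule place_subring_valued_evaluation[OF V'(1)])
  interpret V'd: uniformized UNIV V' "x - emb a"
    by unfold_locales (use V'(2) x_minus_const_nz in auto)
  have "Q \<subseteq> nonunits V'"
  proof
    fix z assume z: "z \<in> Q"
    show "z \<in> nonunits V'"
    proof (cases "z = 0")
      case True
      then show ?thesis using V'.zero_nonunit by simp
    next
      case False
      have "z \<in> rational_functions" using z R(2) R.subset by (auto simp: R.nonunits_iff)
      then obtain A B where AB: "B \<noteq> 0" "z = X.eval A / X.eval B"
        using rational_functions_quotient by blast
      then have A: "A \<noteq> 0" using False by auto
      have "int (Polynomial.order a A) - int (Polynomial.order a B) > 0"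
        using Rd.has_value_nonunit_iff[OF R.eval_quotient_value[OF near_R A AB(1) x_minus_const_nz]]
          z R(2) AB(2) by blast
      then show ?thesis
        using V'd.has_value_nonunit_iff[OF V'.eval_quotient_value[OF V'(2) A AB(1) x_minus_const_nz]]
          AB(2) by blast
    qed
  qed
  then have "nonunits V' \<in> places_over (range emb) UNIV Q"
    using V'(1) places_eq by (auto simp: places_over_def)
  then show False using over place_subring_eqI[OF V'(1) V] \<open>V' \<noteq> V\<close> by simp
qed

text \<open>
  Being the only place over its restriction to \<open>K(x)\<close>, a totally ramified place lies over infinity or
  over a zero of \<open>f\<close>.
\<close>

theorem weierstrass_semigroup_totally_ramified:
  assumes P: "P \<in> places (range emb) UNIV"
    and ramified: "totally_ramified (range emb) (field_gen (range emb) {x}) UNIV P"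
  shows "weierstrass_semigroup (range emb) UNIV P =
    (if P = P_infty (range emb) x then {m * i + r * j | i j. True}
     else {n. \<exists>j k. j < m \<and> n + j = m * k \<and> r * j \<le> m * k})"
proof -
  obtain V where V: "place_subring V" "P = nonunits V" using P places_eq by auto
  show ?thesis
  proof (cases "x \<in> V")
    case False
    then show ?thesis
      using P_infty_eq[OF V(1)] weierstrass_semigroup_infinite[OF V(1)] V(2) by simp
  next
    case True
    obtain V' where V': "place_subring V'" "x \<notin> V'" by (rule infinite_place_exists)
    have "P \<noteq> P_infty (range emb) x"
      unfolding P_infty_eq[OF V'] V(2) using place_subring_eqI[OF V(1) V'(1)] True V'(2) by blast
    moreover obtain a where a: "x - emb a \<in> nonunits V" using near_point_exists[OF V(1) True] by blast
    moreover have "poly f a = 0"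
      using ramified unique_over_imp_root[OF V(1) a]
      unfolding totally_ramified_def rational_functions_def V(2) by blast
    ultimately show ?thesis using weierstrass_semigroup_root[OF V(1) a] V(2) by simp
  qed
qed

end

section \<open>The gap formula\<close>

text \<open>
  Gaps and non-gaps \<open>n = m k - j\<close> are separated by comparing \<open>m k\<close> with \<open>r j\<close>. The substitution
  \<open>i = m - 1 - j\<close> and \<open>j' = k - 1\<close> turns \<open>m k < r j\<close> into the upper bound on \<open>j'\<close>.
\<close>

lemma gaps_eq:
  fixes m r :: nat
  assumes m: "m > 0" and r: "r > 0"
  shows "{n. \<exists>j k. j < m \<and> n + j = m * k \<and> r * j \<le> m * k} =
    UNIV - {n. int n \<in> {1 + i + int m * j | i j :: int.
      0 \<le> i \<and> i \<le> int m - 2 - \<lfloor>real m / real r\<rfloor> \<and>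
      0 \<le> j \<and> j \<le> int r - 2 - \<lfloor>real r * (of_int i + 1) / real m\<rfloor>}}"
    (is "?H = UNIV - ?G")
proof -
  have bound: "j \<le> int r - 2 - \<lfloor>real r * (of_int i + 1) / real m\<rfloor> \<longleftrightarrow>
      int m * (j + 1) < int r * (int m - 1 - i)" for i j :: int
  proof -
    have "j \<le> int r - 2 - \<lfloor>real r * (of_int i + 1) / real m\<rfloor> \<longleftrightarrow>
        \<lfloor>real r * (of_int i + 1) / real m\<rfloor> < int r - 1 - j" by linarith
    also have "\<dots> \<longleftrightarrow> real r * (of_int i + 1) / real m < of_int (int r - 1 - j)"
      by (rule floor_less_iff)
    also have "\<dots> \<longleftrightarrow> real r * (of_int i + 1) < of_int (int r - 1 - j) * real m"
      using m by (simp add: pos_divide_less_eq)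
    also have "\<dots> \<longleftrightarrow> real_of_int (int r * (i + 1)) < real_of_int ((int r - 1 - j) * int m)"
      by simp
    also have "\<dots> \<longleftrightarrow> int r * (i + 1) < (int r - 1 - j) * int m" by (rule of_int_less_iff)
    also have "\<dots> \<longleftrightarrow> int m * (j + 1) < int r * (int m - 1 - i)" by (simp add: algebra_simps)
    finally show ?thesis .
  qed
  have bound_i: "i \<le> int m - 2 - \<lfloor>real m / real r\<rfloor> \<longleftrightarrow> int m < int r * (int m - 1 - i)" for i :: int
  proof -
    have "i \<le> int m - 2 - \<lfloor>real m / real r\<rfloor> \<longleftrightarrow> \<lfloor>real m / real r\<rfloor> < int m - 1 - i" by linarith
    also have "\<dots> \<longleftrightarrow> real m / real r < of_int (int m - 1 - i)" by (rule floor_less_iff)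
    also have "\<dots> \<longleftrightarrow> real m < of_int (int m - 1 - i) * real r"
      using r by (simp add: pos_divide_less_eq)
    also have "\<dots> \<longleftrightarrow> real_of_int (int m) < real_of_int ((int m - 1 - i) * int r)" by simp
    also have "\<dots> \<longleftrightarrow> int m < (int m - 1 - i) * int r" by (rule of_int_less_iff)
    finally show ?thesis by (simp add: mult.commute)
  qed
  have G: "n \<in> ?G \<longleftrightarrow> (\<exists>i j. int n = 1 + i + int m * j \<and> 0 \<le> i \<and> int m < int r * (int m - 1 - i)
      \<and> 0 \<le> j \<and> int m * (j + 1) < int r * (int m - 1 - i))" for n
    unfolding bound bound_i by blast
  have "n \<in> ?H \<longleftrightarrow> n \<notin> ?G" for n
  proof
    assume "n \<in> ?H"
    then obtain j k where jk: "j < m" "n + j = m * k" "r * j \<le> m * k" by blast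
    show "n \<notin> ?G"
    proof
      assume "n \<in> ?G"
      then obtain i j' where ij: "int n = 1 + i + int m * j'" "0 \<le> i"
        "int m < int r * (int m - 1 - i)" "int m * (j' + 1) < int r * (int m - 1 - i)"
        unfolding G by blast
      have "0 < int r * (int m - 1 - i)" using ij(3) m by linarith
      then have i: "i < int m - 1" by (simp add: zero_less_mult_iff)
      have "int (n + j) = int (m * k)" using jk(2) by (rule arg_cong)
      then have "int m * (int k - j' - 1) = int j - (int m - 1 - i)"
        using ij(1) by (simp add: algebra_simps)
      moreover from this have "int m dvd int j - (int m - 1 - i)" by (metis dvd_triv_left)
      moreover have "\<bar>int j - (int m - 1 - i)\<bar> < int m" using i ij(2) jk(1) by linarith
      ultimately have j: "int j = int m - 1 - i" "int m * (int k - j' - 1) = 0"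
        using dvd_imp_le_int[of "int j - (int m - 1 - i)" "int m"] by auto
      then have "int k = j' + 1" using m by simp
      then have "int (m * k) < int (r * j)" using ij(4) j(1) by simp
      then show False using jk(3) by (simp only: of_nat_less_iff)
    qed
  next
    assume n: "n \<notin> ?G"
    (* k is n / m rounded up, which makes n = m k - j with 0 \<le> j < m *)
    define k where "k = (n + (m - 1)) div m"
    define j where "j = m * k - n"
    have "n + (m - 1) = m * k + (n + (m - 1)) mod m" by (simp add: k_def)
    moreover have "(n + (m - 1)) mod m < m" using m by simp
    ultimately have jk: "j < m" "n + j = m * k" using m unfolding j_def by linarith+
    have "r * j \<le> m * k"
    proof (rule ccontr)
      assume "\<not> r * j \<le> m * k"
      then have less: "int m * int k < int r * int j"
        by (simp flip: of_nat_mult)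
      then have "j > 0" by (intro Nat.gr0I) (auto simp: mult_less_0_iff)
      then have "m * k > 0" using jk(2) by linarith
      then have k: "k > 0" by simp
      have "int n + int j = int m * int k" using jk(2) by (simp flip: of_nat_add of_nat_mult)
      have "int m * 1 \<le> int m * int k" using k by (intro mult_left_mono) auto
      then have "int m < int r * int j" using less by simp
      moreover have "int n = 1 + (int m - 1 - int j) + int m * (int k - 1)"
        using \<open>int n + int j = int m * int k\<close> by (simp add: right_diff_distrib)
      ultimately have "n \<in> ?G"
        unfolding G using less jk(1) k
        by (intro exI[of _ "int m - 1 - int j"] exI[of _ "int k - 1"]) simp
      then show False using n by blast
    qed
    then show "n \<in> ?H" using jk by blast
  qed
  then show ?thesis by blast
qed

lemma generated_submonoid_two: "generated_submonoid {m, r} = {m * i + r * j | i j. True}"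
  unfolding generated_submonoid_def
proof (rule hull_unique)
  show "{m, r} \<subseteq> {m * i + r * j | i j. True}"
    by (auto intro: exI[of _ "1::nat"] exI[of _ "0::nat"])
  have "m * i + r * j + (m * i' + r * j') = m * (i + i') + r * (j + j')" for i j i' j'
    by (simp add: algebra_simps)
  then show "0 \<in> {m * i + r * j | i j. True} \<and> (\<forall>a\<in>{m * i + r * j | i j. True}.
      \<forall>b\<in>{m * i + r * j | i j. True}. a + b \<in> {m * i + r * j | i j. True})"
    by auto blast
next
  fix M assume M: "{m, r} \<subseteq> M" "0 \<in> M \<and> (\<forall>a\<in>M. \<forall>b\<in>M. a + b \<in> M)"
  have mult: "a * i \<in> M" if "a \<in> M" for a i
    using that M(2) by (induction i) auto
  show "{m * i + r * j | i j. True} \<subseteq> M"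
    using M mult[of m] mult[of r] by auto
qed

section \<open>Kummer extensions as superelliptic curves\<close>

lemma ring_of_type_algebra_nat_pow:
  "a [^]\<^bsub>ring_of_type_algebra\<^esub> (n :: nat) = (a :: 'a::comm_ring_1) ^ n"
  by (induction n) (simp_all add: nat_pow_def)

lemma algebra_eval_eq_poly:
  "ring.eval ring_of_type_algebra xs (a :: 'a::comm_ring_1) = poly (Poly (rev xs)) a"
proof -
  interpret R: ring "ring_of_type_algebra :: 'a ring" ..
  show ?thesis
    by (induction xs) (simp_all add: ring_of_type_algebra_nat_pow Poly_append poly_monom mult.commute)
qed

text \<open>
  Translates transcendence from coefficient lists with the leading coefficient first to the type of
  polynomials.
\<close>

lemma transcendental_imp:
  assumes trans: "ring.transcendental ring_of_type_algebra (range emb) (x :: 'f::field)"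
    and h0: "emb 0 = 0" and inj: "inj emb"
    and zero: "poly (map_poly emb p) x = 0"
  shows "p = 0"
proof (rule ccontr)
  assume p: "p \<noteq> 0"
  interpret R: ring "ring_of_type_algebra :: 'f ring" ..
  define q where "q = map_poly emb p"
  have q: "q \<noteq> 0"
  proof
    assume "q = 0"
    then have "emb (Polynomial.coeff p i) = emb 0" for i
      using h0 by (metis q_def coeff_map_poly coeff_0)
    then have "Polynomial.coeff p i = 0" for i using inj by (blast dest: injD)
    then show False using p by (auto simp: poly_eq_iff)
  qed
  define P where "P = rev (coeffs q)"
  have "set P \<subseteq> range emb"
  proof
    fix a assume "a \<in> set P"
    then obtain i where "a = Polynomial.coeff q i" by (auto simp: P_def coeffs_def q)
    then show "a \<in> range emb" by (simp add: q_def coeff_map_poly h0)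
  qed
  moreover have "P \<noteq> []" using q by (simp add: P_def)
  moreover have "hd P \<noteq> 0" using q by (simp add: P_def hd_rev last_coeffs_eq_coeff_degree)
  ultimately have "P \<in> carrier (univ_poly ring_of_type_algebra (range emb))"
    by (simp add: univ_poly_def polynomial_def)
  moreover have "[] \<in> carrier (univ_poly ring_of_type_algebra (range emb))"
    by (simp add: univ_poly_def polynomial_def)
  moreover have "ring.eval ring_of_type_algebra P x = ring.eval ring_of_type_algebra [] x"
    using zero by (simp add: algebra_eval_eq_poly P_def q_def)
  ultimately have "P = []"
    using trans unfolding R.transcendental_def inj_on_def by blast
  then show False using \<open>P \<noteq> []\<close> by blast
qed

text \<open>
  With \<open>a \<lambda> + b m = 1\<close>, the element \<open>w = y\<^sup>a f(x)\<^sup>b\<close> satisfies \<open>w\<^sup>m = f(x)\<close> and \<open>y = w\<^sup>\<lambda>\<close>. So the exponent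
  \<open>\<lambda>\<close> does not change the field.
\<close>

lemma root_of_power_equation:
  fixes y g :: "'f::field"
  assumes "y ^ m = g ^ l" "coprime m l" "y \<noteq> 0" "g \<noteq> 0"
  obtains w where "w ^ m = g" "y = w ^ l"
proof -
  obtain a b :: int where ab: "a * int l + b * int m = 1"
    using bezout_int[of "int l" "int m"] assms(2) by (auto simp: coprime_iff_gcd_eq_1 gcd.commute[of l])
  have pow: "y powi (int m * c) = g powi (int l * c)" for c
    using arg_cong[OF assms(1), of "\<lambda>z. z powi c"] by (simp add: power_int_mult)
  define w where "w = y powi a * g powi b"
  have "w powi int m = y powi (int m * a) * g powi (b * int m)"
    by (simp add: w_def power_int_mult power_mult_distrib mult.commute[of "int m" a])
  also have "\<dots> = g powi (a * int l + b * int m)"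
    unfolding pow using assms(4) by (simp add: power_int_add mult.commute)
  finally have 1: "w ^ m = g" using ab by simp
  have "w powi int l = y powi (a * int l) * g powi (int l * b)"
    by (simp add: w_def power_int_mult power_mult_distrib mult.commute[of "int l" b])
  also have "\<dots> = y powi (a * int l + b * int m)"
    unfolding pow [symmetric] using assms(3) by (simp add: power_int_add mult.commute)
  finally have "y = w ^ l" using ab by simp
  with 1 show ?thesis using that by blast
qed

lemma kummer_extension_superelliptic:
  fixes emb :: "'q::finite_field alg_closure \<Rightarrow> 'f::field"
  assumes kummer: "kummer_extension emb x y f m l r \<alpha>"
    and squarefree: "rsquarefree (map_poly to_ac f)"
    and degree: "Polynomial.degree f = r"
  obtains w where "superelliptic emb x w (map_poly to_ac f) m r"
proof -
  interpret kummer_extension emb x y f m l r \<alpha> by (rule kummer)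
  define g where "g = map_poly to_ac f"
  have emb_hom: "emb 1 = 1" "\<And>a b. emb (a + b) = emb a + emb b" "\<And>a b. emb (a * b) = emb a * emb b"
    using ring_hom_one[OF emb] ring_hom_add[OF emb] ring_hom_mult[OF emb] by simp_all
  interpret X: evaluation emb x by unfold_locales (fact emb_hom)+
  have inj: "inj emb"
  proof (rule injI)
    fix a b assume "emb a = emb b"
    then have "emb (a - b) = 0" by (simp add: X.h_diff)
    moreover have "emb (a - b) * emb (inverse (a - b)) = 1" if "a \<noteq> b"
      using that by (simp flip: emb_hom(3) add: emb_hom(1))
    ultimately show "a = b" by force
  qed
  have trans: "p = 0" if "poly (map_poly emb p) x = 0" for p
    using transcendental_imp[OF transcendental X.h_0 inj that] .
  have g: "map_poly (\<lambda>a. emb (to_ac a)) f = map_poly emb g"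
    by (simp add: g_def map_poly_map_poly X.h_0 o_def)
  have g_nz: "g \<noteq> 0" using squarefree by (auto simp: g_def rsquarefree_def)
  have gx_nz: "poly (map_poly emb g) x \<noteq> 0" using trans g_nz by blast
  have y_eq: "y ^ m = poly (map_poly emb g) x ^ l" using equation by (simp add: g)
  have y_nz: "y \<noteq> 0" using y_eq gx_nz m_ge_2 by (auto simp: power_0_left)
  have cop: "coprime m l" "coprime m r" using coprime by auto
  obtain w where w: "w ^ m = poly (map_poly emb g) x" "y = w ^ l"
    using root_of_power_equation[OF y_eq cop(1) y_nz gx_nz] .
  have gen: "z \<in> generate_field ring_of_type_algebra (range emb \<union> {x, w})"
    if "z \<in> generate_field ring_of_type_algebra (range emb \<union> {x, y})" for z
    using that
  proof (induction rule: generate_field.induct)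
    case (incl z)
    have "w ^ n \<in> generate_field ring_of_type_algebra (range emb \<union> {x, w})" for n
    proof (induction n)
      case 0
      then show ?case using generate_field.one[of ring_of_type_algebra] by simp
    next
      case (Suc n)
      have "w \<in> generate_field ring_of_type_algebra (range emb \<union> {x, w})"
        by (rule generate_field.incl) simp
      from generate_field.eng_mult[OF this Suc] show ?case by simp
    qed
    then show ?case using incl w(2) by (auto intro: generate_field.incl)
  qed (blast intro: generate_field.intros)+
  have "superelliptic emb x w g m r"
  proof
    show "generate_field ring_of_type_algebra (range emb \<union> {x, w}) = UNIV"
      using gen generated unfolding field_gen_def by blast
    show "of_nat m \<noteq> (0 :: 'q alg_closure)"
      using not_dvd by (simp add: of_nat_eq_0_iff_char_dvd)
    show "Polynomial.degree g = r"
      unfolding g_def degree [symmetric] by (rule degree_map_poly) simp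
  qed (use emb_hom trans w(1) m_ge_2 cop(2) squarefree in \<open>simp_all add: g_def\<close>)
  then show ?thesis using that by (simp add: g_def)
qed

theorem theorem3p2:
  fixes emb :: "'q::finite_field alg_closure \<Rightarrow> 'f::field"
    and x y :: 'f
    and f :: "'q poly"
    and m l r :: nat
    and \<alpha> :: "nat \<Rightarrow> 'q alg_closure"
    and K P :: "'f set"
  defines "K \<equiv> range emb"
  assumes "kummer_extension emb x y f m l r \<alpha>"
    and "rsquarefree (map_poly to_ac f)"
    and "Polynomial.degree f = r"
    and "genus K UNIV \<ge> 1"
    and "P \<in> places K UNIV"
    and "totally_ramified K (field_gen K {x}) UNIV P"
  shows "(P \<noteq> P_infty K x \<longrightarrow>
           weierstrass_semigroup K UNIV P =
             UNIV - {n. int n \<in> {1 + i + int m * j | i j :: int.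
                0 \<le> i \<and> i \<le> int m - 2 - \<lfloor>real m / real r\<rfloor> \<and>
                0 \<le> j \<and> j \<le> int r - 2 - \<lfloor>real r * (of_int i + 1) / real m\<rfloor>}}) \<and>
         (P = P_infty K x \<longrightarrow>
           weierstrass_semigroup K UNIV P = generated_submonoid {m, r})"
proof -
  obtain w where "superelliptic emb x w (map_poly to_ac f) m r"
    using kummer_extension_superelliptic assms(2-4) by blast
  then interpret superelliptic emb x w "map_poly to_ac f" m r .
  have "r > 0"
    using coprime_m_r m_ge_2 by (intro Nat.gr0I) auto
  moreover have "m > 0" using m_ge_2 by simp
  moreover note weierstrass_semigroup_totally_ramified[OF assms(6,7)[unfolded K_def]]
  ultimately show ?thesis
    unfolding K_def generated_submonoid_two by (simp only: gaps_eq if_False if_True) simp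
qed

end
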